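(* Let $\Omega$ be a set and $E$ a closed subspace of $\ell^\infty(\Omega)$, let $O \subseteq \mathbb{C}^d$ be open and non-empty, and let $f : O \times \Omega \to \mathbb{C}$ be a bounded function with the following properties: \begin{itemize} \item $F(z) := f(z,\cdot) \in E$ for each $z \in O$, and \item $f_t := f(\cdot,t)$ is holomorphic on $O$ for each $t \in \Omega$. \end{itemize} Finally, let $\varphi : \mathrm{H}^\infty(O) \to \mathbb{C}$ be a bp-continuous linear functional. Then the following assertions hold: (a) $F \in \mathrm{H}^\infty(O;E)$. (b) For each multi-index $\alpha \in \mathbb{N}_0^d$ and each $a \in O$ one has \[ (D^\alpha F)(a) = \bigl( t \mapsto D_z^\alpha f(z,t)\big|_{z=a} \bigr) \in E, \] and, for all $\mu \in E'$, \[ D_z^\alpha \langle t \mapsto f(z,t), \mu \rangle \big|_{z=a} = \bigl\langle t \mapsto D_z^\alpha f(z,t)\big|_{z=a}, \mu \bigr\rangle . \] (c) The function $t \mapsto \varphi(f_t)$ is contained in $\overline{\mathrm{span}}(F(O)) \subseteq E$. (d) For all $\mu \in E'$: \[ \langle t \mapsto \varphi(f_t), \mu \rangle = \varphi\bigl( z \mapsto \langle F(z), \mu \rangle \bigr). \]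
   Context: $\ell^\infty(\Omega)$ is the Banach space of all bounded functions $\Omega \to \mathbb{C}$ with the supremum norm. $E'$ is the dual Banach space of $E$ and $\langle\cdot,\cdot\rangle$ the canonical pairing on $E\times E'$. $\overline{\mathrm{span}}$ denotes the norm-closed linear span. A function from an open set $O \subseteq \mathbb{C}^d$ to a complex Banach space $E$ is holomorphic if it is Fréchet-differentiable with $\mathbb{C}$-linear derivative at each point of $O$. $\mathrm{H}^\infty(O;E)$ is the space of all bounded holomorphic functions $O \to E$ with the supremum norm, and $\mathrm{H}^\infty(O) := \mathrm{H}^\infty(O;\mathbb{C})$. For $\alpha \in \mathbb{N}_0^d$, $D^\alpha = \prod_{j=1}^d \partial^{\alpha_j}/\partial z_j^{\alpha_j}$ is the iterated complex partial derivative, and $D_z^\alpha f(z,t)|_{z=a} := D^\alpha(f(\cdot,t))(a)$. A sequence $(g_n)_n$ of bounded functions on $O$ bp-converges to $g$ if $g_n \to g$ pointwise on $O$ and $\sup_n \|g_n\|_\infty < \infty$. A linear functional $\varphi : \mathrm{H}^\infty(O) \to \mathbb{C}$ is bp-continuous if $\varphi(g_n) \to \varphi(g)$ whenever $(g_n)_n$ is a sequence in $\mathrm{H}^\infty(O)$ that bp-converges to $g \in \mathrm{H}^\infty(O)$. *)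

theory Defs
  imports "HOL-Analysis.Analysis" "HOL-Probability.Discrete_Topology"
begin

section \<open>Complex normed spaces\<close>

class complex_normed_vector = real_normed_vector +
  fixes scaleC :: "complex \<Rightarrow> 'a \<Rightarrow> 'a" (infixr \<open>*\<^sub>C\<close> 75)
  assumes scaleC_add_right: "c *\<^sub>C (x + y) = c *\<^sub>C x + c *\<^sub>C y"
    and scaleC_add_left: "(c + d) *\<^sub>C x = c *\<^sub>C x + d *\<^sub>C x"
    and scaleC_scaleC: "c *\<^sub>C d *\<^sub>C x = (c * d) *\<^sub>C x"
    and scaleC_complex_of_real: "complex_of_real r *\<^sub>C x = r *\<^sub>R x"
    and norm_scaleC: "norm (c *\<^sub>C x) = norm c * norm x"

global_interpretation complex_vector: vector_space
  "scaleC :: complex \<Rightarrow> 'a \<Rightarrow> 'a :: complex_normed_vector"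
proof
  show "1 *\<^sub>C x = x" for x :: 'a
    using scaleC_complex_of_real[of 1 x] by simp
qed (simp_all add: scaleC_add_right scaleC_add_left scaleC_scaleC)

instantiation complex :: complex_normed_vector
begin

definition scaleC_complex :: "complex \<Rightarrow> complex \<Rightarrow> complex" where
  "scaleC_complex c z = c * z"

instance
  by standard (simp_all add: scaleC_complex_def algebra_simps scaleR_conv_of_real norm_mult)

end

lemma bounded_linear_scaleC: "bounded_linear (\<lambda>x :: 'a :: complex_normed_vector. c *\<^sub>C x)"
proof (rule bounded_linear_intro[where K = "norm c"])
  fix r :: real and x :: 'a
  show "c *\<^sub>C (r *\<^sub>R x) = r *\<^sub>R (c *\<^sub>C x)"
    by (simp add: scaleC_scaleC mult.commute flip: scaleC_complex_of_real)
qed (simp_all add: scaleC_add_right norm_scaleC)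

lemma scaleC_cont:
  fixes f :: "'a :: topological_space \<Rightarrow> 'b :: complex_normed_vector"
  assumes "f \<in> bcontfun"
  shows "(\<lambda>x. c *\<^sub>C f x) \<in> bcontfun"
proof -
  have "bounded ((\<lambda>x. c *\<^sub>C x) ` range f)"
    using assms bounded_linear_scaleC by (auto simp: bcontfun_def intro: bounded_linear_image)
  then show ?thesis
    using assms bounded_linear.continuous_on[OF bounded_linear_scaleC, of UNIV f c]
    by (auto simp: bcontfun_def image_image)
qed

instantiation bcontfun :: (topological_space, complex_normed_vector) complex_normed_vector
begin

definition scaleC_bcontfun :: "complex \<Rightarrow> ('a \<Rightarrow>\<^sub>C 'b) \<Rightarrow> 'a \<Rightarrow>\<^sub>C 'b" where
  "scaleC_bcontfun c g = Bcontfun (\<lambda>x. c *\<^sub>C apply_bcontfun g x)"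

lemma apply_scaleC_bcontfun: "apply_bcontfun (c *\<^sub>C g) x = c *\<^sub>C apply_bcontfun g x"
  for g :: "'a \<Rightarrow>\<^sub>C 'b"
  by (simp add: scaleC_bcontfun_def Bcontfun_inverse scaleC_cont apply_bcontfun)

instance
proof
  fix c d :: complex and r :: real and f g :: "'a \<Rightarrow>\<^sub>C 'b"
  show "c *\<^sub>C (f + g) = c *\<^sub>C f + c *\<^sub>C g"
    by (rule bcontfun_eqI) (simp add: apply_scaleC_bcontfun scaleC_add_right)
  show "(c + d) *\<^sub>C f = c *\<^sub>C f + d *\<^sub>C f"
    by (rule bcontfun_eqI) (simp add: apply_scaleC_bcontfun scaleC_add_left)
  show "c *\<^sub>C d *\<^sub>C f = (c * d) *\<^sub>C f"
    by (rule bcontfun_eqI) (simp add: apply_scaleC_bcontfun scaleC_scaleC)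
  show "complex_of_real r *\<^sub>C f = r *\<^sub>R f"
    by (rule bcontfun_eqI) (simp add: apply_scaleC_bcontfun scaleC_complex_of_real)
  have le: "norm (c *\<^sub>C f) \<le> norm c * norm f" for c :: complex and f :: "'a \<Rightarrow>\<^sub>C 'b"
    by (rule norm_bound)
      (simp add: apply_scaleC_bcontfun norm_scaleC mult_left_mono norm_bounded)
  show "norm (c *\<^sub>C f) = norm c * norm f"
  proof (cases "c = 0")
    case True
    then show ?thesis using le[of c f] by simp
  next
    case False
    have "inverse c *\<^sub>C c *\<^sub>C f = f"
    proof (rule bcontfun_eqI)
      fix x
      show "(inverse c *\<^sub>C c *\<^sub>C f) x = f x"
        using False by (simp add: apply_scaleC_bcontfun)
    qed
    then have "norm f \<le> inverse (norm c) * norm (c *\<^sub>C f)"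
      using le[of "inverse c" "c *\<^sub>C f"] by (simp add: norm_inverse)
    then have "norm c * norm f \<le> norm (c *\<^sub>C f)"
      using False by (simp add: field_simps)
    then show ?thesis using le[of c f] by linarith
  qed
qed

end

section \<open>Bounded functions on a set and dual spaces\<close>

text \<open>
  The space of bounded functions on \<open>\<Omega>\<close> is modelled by the bounded functions on the whole type
  that vanish off \<open>\<Omega>\<close>; for these the norm of \<open>bcontfun\<close> is the supremum norm over \<open>\<Omega>\<close>.
  Continuity is no restriction, because \<open>'w discrete\<close> carries the discrete topology. In contrast
  to using a type for \<open>\<Omega>\<close>, this covers the empty set.
\<close>

definition linfty :: "'w set \<Rightarrow> ('w discrete \<Rightarrow>\<^sub>C complex) set" where
  "linfty \<Omega> = {g. \<forall>t. t \<notin> \<Omega> \<longrightarrow> apply_bcontfun g (discrete t) = 0}"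

text \<open>Meaningful only if \<open>g\<close> is bounded on \<open>\<Omega>\<close>, see \<open>fun_in\<close>.\<close>

definition linfty_of :: "'w set \<Rightarrow> ('w \<Rightarrow> complex) \<Rightarrow> 'w discrete \<Rightarrow>\<^sub>C complex" where
  "linfty_of \<Omega> g = Bcontfun (\<lambda>x. if of_discrete x \<in> \<Omega> then g (of_discrete x) else 0)"

definition fun_in :: "'w set \<Rightarrow> ('w \<Rightarrow> complex) \<Rightarrow> ('w discrete \<Rightarrow>\<^sub>C complex) set \<Rightarrow> bool" where
  "fun_in \<Omega> g S \<longleftrightarrow> bounded (g ` \<Omega>) \<and> linfty_of \<Omega> g \<in> S"

text \<open>Only the values on \<open>E\<close> of an element of \<open>dual_space E\<close> matter.\<close>

definition dual_space :: "'e :: complex_normed_vector set \<Rightarrow> ('e \<Rightarrow> complex) set" where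
  "dual_space E = {\<mu>. (\<forall>x\<in>E. \<forall>y\<in>E. \<mu> (x + y) = \<mu> x + \<mu> y) \<and>
     (\<forall>c. \<forall>x\<in>E. \<mu> (c *\<^sub>C x) = c * \<mu> x) \<and> continuous_on E \<mu>}"

section \<open>Holomorphic functions and iterated partial derivatives\<close>

text \<open>Here \<open>E\<close> is the carrier of the target space, a subspace of \<open>'e\<close>.\<close>

definition holomorphic_into ::
    "(complex ^ 'd) set \<Rightarrow> 'e set \<Rightarrow> (complex ^ 'd \<Rightarrow> 'e :: complex_normed_vector) \<Rightarrow> bool" where
  "holomorphic_into U E F \<longleftrightarrow> F ` U \<subseteq> E \<and>
     (\<forall>z\<in>U. \<exists>L. (F has_derivative L) (at z) \<and> range L \<subseteq> E \<and> Vector_Spaces.linear (*s) (*\<^sub>C) L)"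

definition Hinf ::
    "(complex ^ 'd) set \<Rightarrow> 'e set \<Rightarrow> (complex ^ 'd \<Rightarrow> 'e :: complex_normed_vector) set" where
  "Hinf U E = {F. holomorphic_into U E F \<and> bounded (F ` U)}"

definition cpartial ::
    "'d \<Rightarrow> (complex ^ 'd \<Rightarrow> 'e :: complex_normed_vector) \<Rightarrow> complex ^ 'd \<Rightarrow> 'e" where
  "cpartial j F z = Lim (at 0) (\<lambda>h. inverse h *\<^sub>C (F (z + axis j h) - F z))"

text \<open>
  The order on the index type fixes the order of differentiation: for indices \<open>1 < \<dots> < d\<close>, the
  derivative with respect to the last variable is taken first.
\<close>

definition cD ::
    "nat ^ ('d :: {finite, linorder}) \<Rightarrow>
      (complex ^ ('d :: {finite, linorder}) \<Rightarrow> 'e :: complex_normed_vector) \<Rightarrow>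
      complex ^ ('d :: {finite, linorder}) \<Rightarrow> 'e" where
  "cD \<alpha> F = foldr (\<lambda>j. cpartial j ^^ (\<alpha> $ j)) (sorted_list_of_set UNIV) F"

section \<open>Functionals on bounded holomorphic functions\<close>

definition bp_converges ::
    "'a set \<Rightarrow> (nat \<Rightarrow> 'a \<Rightarrow> complex) \<Rightarrow> ('a \<Rightarrow> complex) \<Rightarrow> bool" where
  "bp_converges U gs g \<longleftrightarrow>
     (\<forall>z\<in>U. (\<lambda>n. gs n z) \<longlonglongrightarrow> g z) \<and> (\<exists>C. \<forall>n. \<forall>z\<in>U. norm (gs n z) \<le> C)"

text \<open>
  Members of \<open>Hinf U UNIV\<close> are functions on the whole space that represent their restriction to
  \<open>U\<close>; the first condition says that the functional is well defined on these restrictions.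
\<close>

definition linear_functional_Hinf ::
    "(complex ^ 'd) set \<Rightarrow> ((complex ^ 'd \<Rightarrow> complex) \<Rightarrow> complex) \<Rightarrow> bool" where
  "linear_functional_Hinf U \<phi> \<longleftrightarrow>
     (\<forall>g\<in>Hinf U UNIV. \<forall>h\<in>Hinf U UNIV. (\<forall>z\<in>U. g z = h z) \<longrightarrow> \<phi> g = \<phi> h) \<and>
     (\<forall>g\<in>Hinf U UNIV. \<forall>h\<in>Hinf U UNIV. \<phi> (\<lambda>z. g z + h z) = \<phi> g + \<phi> h) \<and>
     (\<forall>c. \<forall>g\<in>Hinf U UNIV. \<phi> (\<lambda>z. c * g z) = c * \<phi> g)"

definition bp_continuous ::
    "(complex ^ 'd) set \<Rightarrow> ((complex ^ 'd \<Rightarrow> complex) \<Rightarrow> complex) \<Rightarrow> bool" where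
  "bp_continuous U \<phi> \<longleftrightarrow>
     (\<forall>gs g. (\<forall>n. gs n \<in> Hinf U UNIV) \<longrightarrow> g \<in> Hinf U UNIV \<longrightarrow> bp_converges U gs g \<longrightarrow>
       (\<lambda>n. \<phi> (gs n)) \<longlonglongrightarrow> \<phi> g)"

end

theory Submission
  imports Defs "HOL-Complex_Analysis.Complex_Analysis"
begin

text \<open>
  Everything rests on estimates for scalar holomorphic functions that depend only on a bound of the
  function and are therefore uniform in the parameter \<open>t \<in> \<Omega>\<close>.

  Restricting a holomorphic \<open>g\<close> with \<open>\<bar>g\<bar> \<le> C\<close> on \<open>ball z r\<close> to complex lines through \<open>z\<close>, the
  Cauchy inequalities give \<open>\<bar>g (z + h) - g z - Dg(z) h\<bar> \<le> 8 C \<bar>h\<bar>\<^sup>2 / r\<^sup>2\<close> (\<open>hol_Cauchy\<close>). For the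
  functions \<open>f (\<cdot>, t)\<close> this holds with the same constants for all \<open>t\<close>, so the difference
  quotients of \<open>F\<close> converge in the supremum norm to the pointwise derivative, and \<open>E\<close>, being
  closed, contains the limit (\<open>hol_family_has_derivative\<close>, \<open>derivative_in_closed_subspace\<close>). This
  is (a). Since directional derivatives of holomorphic functions are again holomorphic
  (\<open>hol_directional_derivative\<close>) and locally bounded uniformly in \<open>t\<close>, the argument can be
  iterated, which gives (b) (\<open>represents_cD\<close>).

  For (c) and (d) the point is that a bp-continuous functional \<open>\<phi>\<close> is, uniformly on the unit ball of
  \<open>H\<^sup>\<infinity>\<close>, a limit of finite linear combinations of point evaluations
  (\<open>bp_continuous_near_evaluations\<close>). Once \<open>\<bar>\<phi>(g) - \<Sum> c\<^sub>i g(z\<^sub>i)\<bar> \<le> \<epsilon> \<parallel>g\<parallel>\<close> is known for all \<open>g\<close>, taking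
  \<open>g = f (\<cdot>, t)\<close> shows that \<open>t \<mapsto> \<phi>(f\<^sub>t)\<close> has distance at most \<open>\<epsilon> \<parallel>f\<parallel>\<close> from \<open>\<Sum> c\<^sub>i F(z\<^sub>i)\<close>, which
  is (c); and taking \<open>g = \<mu> \<circ> F\<close> shows that both sides of (d) are close to \<open>\<Sum> c\<^sub>i \<mu>(F(z\<^sub>i))\<close>.

  The approximation has two ingredients. On the unit ball, locally uniform Lipschitz bounds turn
  pointwise convergence on a countable dense set into bp-convergence; hence for each \<open>\<epsilon>\<close> there are
  finitely many points such that \<open>\<bar>\<phi>(g)\<bar> \<le> \<epsilon>\<close> for all \<open>g\<close> in the unit ball vanishing at these points
  (\<open>bp_continuous_small_if_vanishing\<close>). A Hahn-Banach argument, made finite by removing one point at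
  a time and separating convex sets in \<open>\<complex>\<^sup>2\<close>, then supplies the coefficients
  (\<open>functional_on_near_evaluations\<close>).
\<close>

section \<open>Cauchy estimates along complex lines\<close>

lemma norm_vector_smult: "norm (c *s x) = norm c * norm x" for x :: "complex ^ 'd"
  by (simp add: norm_vec_def norm_mult L2_set_right_distrib)

lemma bounded_linear_line: "bounded_linear (\<lambda>w. w *s v)" for v :: "complex ^ 'd"
  by (rule bounded_linear_intro[where K = "norm v"])
    (simp_all add: vec_eq_iff norm_vector_smult algebra_simps)

lemma scaleR_eq_smult: "a *\<^sub>R x = complex_of_real a *s x" for x :: "complex ^ 'd"
  unfolding vec_eq_iff vector_scaleR_component vector_smult_component
  by (simp add: scaleR_conv_of_real)

text \<open>
  Uniform quadratic remainders are what passes from scalar functions to functions with values in a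
  space of bounded functions; differentiability itself does not.
\<close>

lemma has_derivative_if_quadratic_remainder:
  fixes f :: "'a :: real_normed_vector \<Rightarrow> 'b :: real_normed_vector"
  assumes L: "bounded_linear L" and r: "0 < r"
    and bd: "\<And>h. norm h \<le> r \<Longrightarrow> norm (f (z + h) - f z - L h) \<le> K * (norm h)\<^sup>2"
  shows "(f has_derivative L) (at z)"
  unfolding has_derivative_at
proof
  have "eventually (\<lambda>h :: 'a. norm h \<le> r) (at 0)"
    using r by (auto simp: eventually_at intro!: exI[of _ r])
  then have "eventually (\<lambda>h. norm (norm (f (z + h) - f z - L h) / norm h) \<le> K * norm h) (at 0)"
  proof eventually_elim
    case (elim h)
    then show ?case
      using bd[OF elim] by (cases "h = 0") (auto simp: divide_simps power2_eq_square mult.assoc)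
  qed
  moreover have "((\<lambda>h :: 'a. K * norm h) \<longlongrightarrow> 0) (at 0)"
    using tendsto_mult_left[OF tendsto_norm_zero[OF tendsto_ident_at], of K] by simp
  ultimately show "((\<lambda>h. norm (f (z + h) - f z - L h) / norm h) \<longlongrightarrow> 0) (at 0)"
    by (rule Lim_null_comparison)
qed (rule L)

text \<open>
  The Cauchy inequality is applied on the disc of radius \<open>r / 2\<close>, because \<open>g\<close> need not extend
  continuously to the boundary; this accounts for the factor 2.
\<close>

lemma Cauchy_bound_deriv:
  assumes hol: "g holomorphic_on ball a r" and r: "0 < r"
    and bd: "\<And>w. w \<in> ball a r \<Longrightarrow> norm (g w) \<le> C"
  shows "norm (deriv g a) \<le> 2 * C / r"
proof -
  have sub: "cball a (r / 2) \<subseteq> ball a r"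
    using r by auto
  have "norm ((deriv ^^ 1) g a) \<le> fact 1 * C / (r / 2) ^ 1"
  proof (rule Cauchy_inequality)
    show "g holomorphic_on ball a (r / 2)"
      using hol by (rule holomorphic_on_subset) (use r in auto)
    show "continuous_on (cball a (r / 2)) g"
      using holomorphic_on_imp_continuous_on[OF hol] sub by (rule continuous_on_subset)
    show "norm (g x) \<le> C" if "norm (a - x) = r / 2" for x
      using that r by (intro bd) (simp add: dist_norm)
  qed (use r in simp)
  then show ?thesis by (simp add: field_simps)
qed

text \<open>
  For \<open>\<bar>x\<bar> \<le> r / 4\<close> the closed disc of radius \<open>r / 2\<close> around \<open>x\<close> lies in the domain, so the second
  derivative is at most \<open>2 C / (r / 2)\<^sup>2\<close> there, and Taylor's formula applies.
\<close>

lemma Cauchy_quadratic_remainder: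
  assumes hol: "g holomorphic_on ball 0 r" and r: "0 < r"
    and bd: "\<And>w. w \<in> ball 0 r \<Longrightarrow> norm (g w) \<le> C" and w: "norm w \<le> r / 4"
  shows "norm (g w - g 0 - w * deriv g 0) \<le> 8 * C / r\<^sup>2 * (norm w)\<^sup>2"
proof -
  have "norm ((deriv ^^ 0) g w - (\<Sum>i\<le>1. (deriv ^^ i) g 0 * (w - 0) ^ i / fact i))
    \<le> 8 * C / r\<^sup>2 * norm (w - 0) ^ Suc 1 / fact 1"
  proof (rule complex_Taylor[where S = "cball 0 (r / 4)"])
    fix i x
    assume x: "x \<in> cball (0 :: complex) (r / 4)"
    then have xr: "x \<in> ball 0 r"
      using r by simp
    show "((deriv ^^ i) g has_field_derivative (deriv ^^ Suc i) g x) (at x within cball 0 (r / 4))"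
      using holomorphic_derivI[OF holomorphic_higher_deriv[OF hol open_ball] open_ball xr]
      by simp
  next
    fix x
    assume x: "x \<in> cball (0 :: complex) (r / 4)"
    have sub: "cball x (r / 2) \<subseteq> ball 0 r"
    proof
      fix y assume "y \<in> cball x (r / 2)"
      then show "y \<in> ball 0 r"
        using x r norm_triangle_ineq[of x "y - x"] by (simp add: dist_norm norm_minus_commute)
    qed
    have "norm ((deriv ^^ 2) g x) \<le> fact 2 * C / (r / 2) ^ 2"
    proof (rule Cauchy_inequality)
      show "g holomorphic_on ball x (r / 2)"
        using hol by (rule holomorphic_on_subset) (use sub ball_subset_cball in blast)
      show "continuous_on (cball x (r / 2)) g"
        using holomorphic_on_imp_continuous_on[OF hol] sub by (rule continuous_on_subset)
      show "norm (g y) \<le> C" if "norm (x - y) = r / 2" for y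
        using that sub by (intro bd) (auto simp: dist_norm)
    qed (use r in simp)
    then show "norm ((deriv ^^ Suc 1) g x) \<le> 8 * C / r\<^sup>2"
      by (simp add: numeral_2_eq_2 field_simps power2_eq_square)
  qed (use w r in auto)
  then show ?thesis
    by (simp add: power2_eq_square algebra_simps)
qed

abbreviation hol :: "(complex ^ 'd) set \<Rightarrow> (complex ^ 'd \<Rightarrow> complex) \<Rightarrow> bool" where
  "hol U g \<equiv> holomorphic_into U UNIV g"

abbreviation fderiv :: "(complex ^ 'd \<Rightarrow> complex) \<Rightarrow> complex ^ 'd \<Rightarrow> complex ^ 'd \<Rightarrow> complex" where
  "fderiv g z \<equiv> frechet_derivative g (at z)"

lemma linear_smult_scaleCI:
  fixes L :: "complex ^ 'd \<Rightarrow> 'e :: complex_normed_vector"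
  assumes "\<And>x y. L (x + y) = L x + L y" "\<And>c x. L (c *s x) = c *\<^sub>C L x"
  shows "Vector_Spaces.linear (*s) (*\<^sub>C) L"
  using assms vec.vector_space_axioms complex_vector.vector_space_axioms
  by (auto simp: Vector_Spaces.linear_iff)

lemma hol_deriv:
  assumes "hol U g" "z \<in> U"
  shows "(g has_derivative fderiv g z) (at z)" and "fderiv g z (c *s h) = c * fderiv g z h"
    and "fderiv g z (h + h') = fderiv g z h + fderiv g z h'" 
proof -
  obtain L where L: "(g has_derivative L) (at z)" "Vector_Spaces.linear (*s) (*\<^sub>C) L"
    using assms by (auto simp: holomorphic_into_def)
  have "fderiv g z = L"
    using frechet_derivative_at[OF L(1)] by simp
  with L show "(g has_derivative fderiv g z) (at z)" "fderiv g z (c *s h) = c * fderiv g z h"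
    "fderiv g z (h + h') = fderiv g z h + fderiv g z h'"
    by (auto simp: Vector_Spaces.linear_iff scaleC_complex_def)
qed

lemma holI:
  assumes "\<And>z. z \<in> U \<Longrightarrow> \<exists>L. (g has_derivative L) (at z) \<and> (\<forall>c h. L (c *s h) = c * L h)"
  shows "hol U g"
  unfolding holomorphic_into_def
proof (intro conjI ballI)
  fix z assume "z \<in> U"
  then obtain L where L: "(g has_derivative L) (at z)" "\<And>c h. L (c *s h) = c * L h"
    using assms by blast
  have "L (x + y) = L x + L y" for x y
    using linear_add[OF has_derivative_linear[OF L(1)]] .
  then have "Vector_Spaces.linear (*s) (*\<^sub>C) L"
    by (intro linear_smult_scaleCI) (simp_all add: L(2) scaleC_complex_def)
  with L show "\<exists>L. (g has_derivative L) (at z) \<and> range L \<subseteq> UNIV \<and> Vector_Spaces.linear (*s) (*\<^sub>C) L"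
    by blast
qed simp

lemma hol_cong:
  assumes U: "open U" and g: "hol U g" and eq: "\<And>z. z \<in> U \<Longrightarrow> g z = h z"
  shows "hol U h"
proof (rule holI)
  fix z assume z: "z \<in> U"
  have "(h has_derivative fderiv g z) (at z)"
    using has_derivative_transform_within_open[OF hol_deriv(1)[OF g z] U z] eq by blast
  then show "\<exists>L. (h has_derivative L) (at z) \<and> (\<forall>c h. L (c *s h) = c * L h)"
    using hol_deriv(2)[OF g z] by blast
qed

lemma hol_line:
  assumes g: "hol U g" and z: "z + w *s v \<in> U"
  shows "((\<lambda>w. g (z + w *s v)) has_field_derivative fderiv g (z + w *s v) v) (at w)"
proof -
  have line: "((\<lambda>w. z + w *s v) has_derivative (\<lambda>w. w *s v)) (at w)"
    using bounded_linear_imp_has_derivative[OF bounded_linear_line[of v], of "at w"]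
      has_derivative_add[OF has_derivative_const[of z "at w"]] by fastforce
  have "((\<lambda>w. g (z + w *s v)) has_derivative (\<lambda>x. fderiv g (z + w *s v) (x *s v))) (at w)"
    using has_derivative_compose[OF line hol_deriv(1)[OF g z]] .
  then show ?thesis
    by (rule has_derivative_imp_has_field_derivative) (simp add: hol_deriv(2)[OF g z])
qed

lemma hol_line_holomorphic:
  assumes g: "hol U g" and S: "open S" and sub: "\<And>w. w \<in> S \<Longrightarrow> z + w *s v \<in> U"
  shows "(\<lambda>w. g (z + w *s v)) holomorphic_on S"
  using hol_line[OF g sub] holomorphic_on_open[OF S] by blast

text \<open>
  With \<open>h = \<bar>h\<bar> u\<close>, both bounds are the one-variable estimates for \<open>w \<mapsto> g (z + w u)\<close> at
  \<open>w = \<bar>h\<bar>\<close>. The constants depend on \<open>g\<close> only through \<open>C\<close>.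
\<close>

lemma hol_Cauchy:
  assumes g: "hol U g" and sub: "ball z r \<subseteq> U" and r: "0 < r"
    and bd: "\<And>w. w \<in> ball z r \<Longrightarrow> norm (g w) \<le> C"
  shows hol_Cauchy_deriv: "norm (fderiv g z h) \<le> 2 * C / r * norm h"
    and hol_Cauchy_remainder:
      "norm h \<le> r / 4 \<Longrightarrow> norm (g (z + h) - g z - fderiv g z h) \<le> 8 * C / r\<^sup>2 * (norm h)\<^sup>2"
proof -
  have z: "z \<in> U" using sub r by auto
  have "norm (fderiv g z h) \<le> 2 * C / r * norm h \<and>
    (norm h \<le> r / 4 \<longrightarrow> norm (g (z + h) - g z - fderiv g z h) \<le> 8 * C / r\<^sup>2 * (norm h)\<^sup>2)"
  proof (cases "h = 0")
    case True
    then show ?thesis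
      using hol_deriv(2)[OF g z, of 0 0] by simp
  next
    case False
    define u where "u = complex_of_real (inverse (norm h)) *s h"
    define k where "k w = g (z + w *s u)" for w
    have u: "norm u = 1" and h: "h = complex_of_real (norm h) *s u"
      using False by (simp_all add: u_def norm_vector_smult norm_inverse vector_smult_assoc del: of_real_inverse flip: of_real_mult)
    have ball: "z + w *s u \<in> ball z r" if "w \<in> ball 0 r" for w
      using that u by (simp add: dist_norm norm_vector_smult)
    have k: "(k has_field_derivative fderiv g (z + w *s u) u) (at w)" if "w \<in> ball 0 r" for w
      unfolding k_def using ball[OF that] sub by (intro hol_line[OF g]) auto
    have k_hol: "k holomorphic_on ball 0 r"
      using k holomorphic_on_open[OF open_ball] by blast
    have kbd: "norm (k w) \<le> C" if "w \<in> ball 0 r" for w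
      unfolding k_def using ball[OF that] by (rule bd)
    have dk: "deriv k 0 = fderiv g z u"
      using DERIV_imp_deriv[OF k[of 0]] r by simp
    have fdh: "fderiv g z h = of_real (norm h) * fderiv g z u"
      using hol_deriv(2)[OF g z, of "of_real (norm h)" u] by (simp only: flip: h)
    have "norm (fderiv g z h) \<le> 2 * C / r * norm h"
      using mult_right_mono[OF Cauchy_bound_deriv[OF k_hol r kbd] norm_ge_zero[of h]]
      by (simp add: dk fdh norm_mult mult.commute)
    moreover have "norm (g (z + h) - g z - fderiv g z h) \<le> 8 * C / r\<^sup>2 * (norm h)\<^sup>2"
      if "norm h \<le> r / 4"
    proof -
      have "k (of_real (norm h)) = g (z + h)" "k 0 = g z"
        unfolding k_def by (simp_all flip: h)
      then show ?thesis
        using Cauchy_quadratic_remainder[OF k_hol r kbd, of "of_real (norm h)"] that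
        by (simp add: dk fdh)
    qed
    ultimately show ?thesis by blast
  qed
  then show "norm (fderiv g z h) \<le> 2 * C / r * norm h"
    "norm h \<le> r / 4 \<Longrightarrow> norm (g (z + h) - g z - fderiv g z h) \<le> 8 * C / r\<^sup>2 * (norm h)\<^sup>2"
    by blast+
qed

text \<open>
  Functions with a common bound are thus equicontinuous at \<open>z\<close>.
\<close>

lemma hol_Lipschitz:
  assumes g: "hol U g" and sub: "ball z r \<subseteq> U" and r: "0 < r"
    and bd: "\<And>w. w \<in> ball z r \<Longrightarrow> norm (g w) \<le> C" and h: "norm h \<le> r / 4"
  shows "norm (g (z + h) - g z) \<le> 4 * C / r * norm h"
proof -
  have C: "0 \<le> C"
    using bd[of z] r norm_ge_zero[of "g z"] by (simp del: norm_ge_zero)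
  have "norm (g (z + h) - g z) \<le> norm (g (z + h) - g z - fderiv g z h) + norm (fderiv g z h)"
    using norm_triangle_ineq[of "g (z + h) - g z - fderiv g z h" "fderiv g z h"] by simp
  also have "\<dots> \<le> 8 * C / r\<^sup>2 * (norm h)\<^sup>2 + 2 * C / r * norm h"
    by (intro add_mono hol_Cauchy_remainder[OF g sub r bd h] hol_Cauchy_deriv[OF g sub r bd])
  also have "8 * C / r\<^sup>2 * (norm h)\<^sup>2 \<le> 8 * C / r\<^sup>2 * (norm h * (r / 4))"
    using C mult_left_mono[OF h norm_ge_zero[of h]]
    by (intro mult_left_mono) (auto simp: power2_eq_square)
  finally show ?thesis
    using r by (simp add: field_simps power2_eq_square)
qed

lemma hol_locally_bounded:
  assumes g: "hol U g" and U: "open U" and z: "z \<in> U"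
  obtains r C where "0 < r" "ball z r \<subseteq> U" "\<And>w. w \<in> ball z r \<Longrightarrow> norm (g w) \<le> C"
proof -
  obtain r where r: "0 < r" "cball z r \<subseteq> U"
    using U z open_contains_cball by blast
  have "continuous_on U g"
    by (intro continuous_at_imp_continuous_on ballI has_derivative_continuous[OF hol_deriv(1)[OF g]])
  then have "compact (g ` cball z r)"
    using compact_continuous_image[OF continuous_on_subset[OF _ r(2)] compact_cball] by blast
  then have "bounded (g ` cball z r)"
    by (rule compact_imp_bounded)
  then obtain C where "\<And>w. w \<in> cball z r \<Longrightarrow> norm (g w) \<le> C"
    by (auto simp only: bounded_iff ball_simps)
  then show ?thesis
    using r ball_subset_cball[of z r] by (intro that[of r C]) blast+
qed

section \<open>Holomorphy of directional derivatives\<close>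

text \<open>
  The remainder \<open>k w = g (z + h + w v) - g (z + w v) - Dg(z + w v) h\<close> is bounded by a multiple of
  \<open>\<bar>h\<bar>\<^sup>2\<close>, uniformly for small \<open>w\<close>. It is holomorphic in \<open>w\<close>, because \<open>Dg(z + w v) h\<close> is a uniform
  limit of difference quotients in the direction \<open>h\<close>. The Cauchy inequality therefore bounds its
  derivative at \<open>w = 0\<close>, which is \<open>Dg(z + h) v - Dg(z) v - \<Lambda> h\<close> with \<open>\<Lambda> h\<close> the derivative of
  \<open>Dg(z + w v) h\<close> at \<open>w = 0\<close>, also by a multiple of \<open>\<bar>h\<bar>\<^sup>2\<close>. As \<open>\<Lambda>\<close> is linear in \<open>h\<close>, it is
  the Frechet derivative of \<open>z \<mapsto> Dg(z) v\<close>.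
\<close>

lemma hol_directional_derivative:
  assumes U: "open U" and g: "hol U g"
  shows "hol U (\<lambda>z. fderiv g z v)"
proof (rule holI)
  fix z assume "z \<in> U"
  then obtain r C where r: "0 < r" "ball z r \<subseteq> U" and C: "\<And>w. w \<in> ball z r \<Longrightarrow> norm (g w) \<le> C"
    using hol_locally_bounded[OF g U] by blast
  define R where "R = r / 2"
  define K where "K = 8 * C / R\<^sup>2"
  \<comment> \<open>For \<open>\<bar>w\<bar> < \<rho>\<close> the ball of radius \<open>R\<close> around \<open>z + w v\<close> stays in \<open>ball z r\<close>; adding 1 covers
    \<open>v = 0\<close>.\<close>
  define \<rho> where "\<rho> = R / (norm v + 1)"
  have R: "0 < R" and \<rho>: "0 < \<rho>"
    using r by (auto simp: R_def \<rho>_def add_nonneg_pos)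
  have near: "norm (w *s v) < R" if "w \<in> ball 0 \<rho>" for w
  proof -
    have "norm w * norm v \<le> norm w * (norm v + 1)"
      by (simp add: mult_left_mono)
    also have "\<dots> < R"
      using that by (simp add: \<rho>_def pos_less_divide_eq add_nonneg_pos)
    finally show ?thesis
      by (simp add: norm_vector_smult)
  qed
  have inU: "z + h + w *s v \<in> ball z r" if "w \<in> ball 0 \<rho>" "norm h \<le> R / 4" for h w
  proof -
    have "dist z (z + h + w *s v) = norm (h + w *s v)"
      by (metis add.assoc add_diff_cancel_left' dist_commute dist_norm)
    also have "\<dots> < r"
      using near[OF that(1)] that(2) norm_triangle_ineq[of h "w *s v"] R by (simp add: R_def)
    finally show ?thesis by simp
  qed
  have rem: "norm (g (z + h + w *s v) - g (z + w *s v) - fderiv g (z + w *s v) h) \<le> K * (norm h)\<^sup>2"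
    if w: "w \<in> ball 0 \<rho>" and h: "norm h \<le> R / 4" for h w
  proof -
    have sub: "ball (z + w *s v) R \<subseteq> ball z r"
    proof
      fix y assume "y \<in> ball (z + w *s v) R"
      then have "dist z (z + w *s v) + dist (z + w *s v) y < r"
        using near[OF w] by (simp add: dist_norm R_def)
      then show "y \<in> ball z r"
        using dist_triangle[of z y "z + w *s v"] by simp
    qed
    have "norm (g (z + w *s v + h) - g (z + w *s v) - fderiv g (z + w *s v) h) \<le> K * (norm h)\<^sup>2"
      unfolding K_def using sub r C R h by (intro hol_Cauchy_remainder[OF g]) auto
    then show ?thesis by (simp add: add_ac)
  qed
  have line_hol: "(\<lambda>w. g (z + h + w *s v)) holomorphic_on ball 0 \<rho>" if "norm h \<le> R / 4" for h
    using inU that r by (intro hol_line_holomorphic[OF g]) auto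
  have line_hol0: "(\<lambda>w. g (z + w *s v)) holomorphic_on ball 0 \<rho>"
    using line_hol[of 0] R by simp
  have D_hol: "(\<lambda>w. fderiv g (z + w *s v) h) holomorphic_on ball 0 \<rho>" for h
  proof -
    \<comment> \<open>A null sequence of step sizes, small enough for the remainder estimate.\<close>
    define s where "s n = R / 4 / (norm h + 1) * inverse (real (Suc n))" for n
    define q where "q n w = inverse (of_real (s n)) *
      (g (z + complex_of_real (s n) *s h + w *s v) - g (z + w *s v))" for n w
    have s: "0 < s n" "norm (complex_of_real (s n) *s h) \<le> R / 4" for n
    proof -
      show pos: "0 < s n"
        using R by (simp add: s_def add_nonneg_pos)
      have "s n * norm h \<le> R / 4 / (norm h + 1) * 1 * (norm h + 1)"
        unfolding s_def using R by (intro mult_mono) (auto simp: field_simps)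
      also have "\<dots> = R / 4"
        using nonzero_mult_div_cancel_right[of "norm h + 1" "R / 4"] norm_ge_zero[of h] by simp
      finally show "norm (complex_of_real (s n) *s h) \<le> R / 4"
        using pos by (simp add: norm_vector_smult)
    qed
    have err: "dist (q n w) (fderiv g (z + w *s v) h) \<le> K * (norm h)\<^sup>2 * s n" if w: "w \<in> ball 0 \<rho>" for n w
    proof -
      have yU: "z + w *s v \<in> U"
        using inU[OF w, of 0] r R by auto
      have "q n w - fderiv g (z + w *s v) h = inverse (of_real (s n)) *
        (g (z + complex_of_real (s n) *s h + w *s v) - g (z + w *s v)
          - fderiv g (z + w *s v) (complex_of_real (s n) *s h))"
        using s(1)[of n] by (simp add: q_def hol_deriv(2)[OF g yU] field_simps)
      also have "norm \<dots> \<le> inverse (s n) * (K * (norm (complex_of_real (s n) *s h))\<^sup>2)"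
        using rem[OF w s(2)] s(1)[of n] unfolding norm_mult
        by (intro mult_mono) (auto simp: norm_inverse)
      also have "\<dots> = K * (norm h)\<^sup>2 * s n"
        using s(1)[of n] by (simp add: norm_vector_smult power2_eq_square field_simps)
      finally show ?thesis by (simp add: dist_norm)
    qed
    have "(\<lambda>n. K * (norm h)\<^sup>2 * s n) \<longlonglongrightarrow> K * (norm h)\<^sup>2 * (R / 4 / (norm h + 1) * 0)"
      unfolding s_def by (intro tendsto_intros LIMSEQ_inverse_real_of_nat)
    then have null: "(\<lambda>n. K * (norm h)\<^sup>2 * s n) \<longlonglongrightarrow> 0"
      by simp
    have lim: "uniform_limit (ball 0 \<rho>) q (\<lambda>w. fderiv g (z + w *s v) h) sequentially"
    proof (rule uniform_limitI)
      fix e :: real assume "0 < e"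
      then have "eventually (\<lambda>n. K * (norm h)\<^sup>2 * s n < e) sequentially"
        using null order_tendstoD(2) by blast
      then show "eventually (\<lambda>n. \<forall>w\<in>ball 0 \<rho>. dist (q n w) (fderiv g (z + w *s v) h) < e) sequentially"
        by eventually_elim (use err le_less_trans in blast)
    qed
    show ?thesis
    proof (rule holomorphic_uniform_sequence[where f = q])
      show "q n holomorphic_on ball 0 \<rho>" for n
        unfolding q_def by (intro holomorphic_intros line_hol s line_hol0)
      show "\<exists>d>0. cball x d \<subseteq> ball 0 \<rho> \<and> uniform_limit (cball x d) q (\<lambda>w. fderiv g (z + w *s v) h) sequentially"
        if "x \<in> ball 0 \<rho>" for x
        using that open_contains_cball[of "ball 0 \<rho>"] uniform_limit_on_subset[OF lim] by blast
    qed simp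
  qed
  have diff: "(\<lambda>w. fderiv g (z + w *s v) h) field_differentiable at 0" for h
    using D_hol \<rho> by (intro holomorphic_on_imp_differentiable_at[of _ "ball 0 \<rho>"]) auto
  define \<Lambda> where "\<Lambda> h = deriv (\<lambda>w. fderiv g (z + w *s v) h) 0" for h
  have ev: "eventually (\<lambda>w. z + w *s v \<in> U) (nhds 0)"
    using inU[of _ 0] r \<rho> R by (intro eventually_nhds_in_open[of "ball 0 \<rho>", THEN eventually_mono]) auto
  have smult: "\<Lambda> (c *s h) = c * \<Lambda> h" for c h
  proof -
    have "\<Lambda> (c *s h) = deriv (\<lambda>w. c * fderiv g (z + w *s v) h) 0"
      unfolding \<Lambda>_def by (rule deriv_cong_ev[OF eventually_mono[OF ev]])
        (simp_all add: hol_deriv(2)[OF g])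
    then show ?thesis
      by (simp add: \<Lambda>_def deriv_cmult diff)
  qed
  have add: "\<Lambda> (h + h') = \<Lambda> h + \<Lambda> h'" for h h'
  proof -
    have "\<Lambda> (h + h') = deriv (\<lambda>w. fderiv g (z + w *s v) h + fderiv g (z + w *s v) h') 0"
      unfolding \<Lambda>_def by (rule deriv_cong_ev[OF eventually_mono[OF ev]])
        (simp_all add: hol_deriv(3)[OF g])
    then show ?thesis
      by (simp add: \<Lambda>_def deriv_add diff)
  qed
  have "linear \<Lambda>"
    by (rule linearI) (simp_all add: add smult scaleR_eq_smult scaleR_conv_of_real)
  then have lin: "bounded_linear \<Lambda>"
    by (simp add: linear_conv_bounded_linear)
  have "((\<lambda>z. fderiv g z v) has_derivative \<Lambda>) (at z)"
  proof (rule has_derivative_if_quadratic_remainder[OF lin])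
    show "0 < R / 4" using R by simp
    fix h :: "complex ^ 'a"
    assume h: "norm h \<le> R / 4"
    define k where "k w = g (z + h + w *s v) - g (z + w *s v) - fderiv g (z + w *s v) h" for w
    have zh: "z + h + 0 *s v \<in> U" "z + 0 *s v \<in> U"
      using inU[of 0 h] inU[of 0 0] h r \<rho> R by (auto simp del: mem_ball)
    have "(k has_field_derivative fderiv g (z + h + 0 *s v) v - fderiv g (z + 0 *s v) v - \<Lambda> h) (at 0)"
      unfolding k_def \<Lambda>_def
      by (intro DERIV_diff hol_line[OF g] zh field_differentiable_derivI diff)
    then have dk: "deriv k 0 = fderiv g (z + h) v - fderiv g z v - \<Lambda> h"
      using DERIV_imp_deriv by fastforce
    have "norm (deriv k 0) \<le> 2 * (K * (norm h)\<^sup>2) / \<rho>"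
    proof (rule Cauchy_bound_deriv[OF _ \<rho>])
      show "k holomorphic_on ball 0 \<rho>"
        unfolding k_def by (intro holomorphic_intros line_hol[OF h] line_hol0 D_hol)
    qed (use rem[OF _ h] in \<open>simp add: k_def\<close>)
    then show "norm (fderiv g (z + h) v - fderiv g z v - \<Lambda> h) \<le> 2 * K / \<rho> * (norm h)\<^sup>2"
      by (simp add: dk)
  qed
  then show "\<exists>L. ((\<lambda>z. fderiv g z v) has_derivative L) (at z) \<and> (\<forall>c h. L (c *s h) = c * L h)"
    using smult by blast
qed

section \<open>Bounded functions of a parameter\<close>

lemma apply_linfty_of:
  assumes "bounded (g ` \<Omega>)"
  shows "apply_bcontfun (linfty_of \<Omega> g) x = (if of_discrete x \<in> \<Omega> then g (of_discrete x) else 0)"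
proof -
  let ?g = "\<lambda>x. if of_discrete x \<in> \<Omega> then g (of_discrete x) else 0"
  have "range ?g \<subseteq> insert 0 (g ` \<Omega>)"
    by auto
  then have "bounded (range ?g)"
    using assms bounded_insert bounded_subset by blast
  moreover have "continuous_on UNIV ?g"
    by (auto simp: continuous_on_open_vimage open_discrete)
  ultimately have "?g \<in> bcontfun"
    by (simp add: bcontfun_def)
  then show ?thesis
    by (simp add: linfty_of_def Bcontfun_inverse)
qed

lemma norm_linfty_of_le:
  assumes "\<And>t. t \<in> \<Omega> \<Longrightarrow> norm (g t) \<le> C" "0 \<le> C"
  shows "norm (linfty_of \<Omega> g) \<le> C"
proof (rule norm_bound)
  have "bounded (g ` \<Omega>)"
    using assms by (auto simp: bounded_iff)
  then show "norm (apply_bcontfun (linfty_of \<Omega> g) x) \<le> C" for x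
    using assms by (simp add: apply_linfty_of)
qed

lemma linfty_of_cong: "(\<And>t. t \<in> \<Omega> \<Longrightarrow> g t = h t) \<Longrightarrow> linfty_of \<Omega> g = linfty_of \<Omega> h"
  unfolding linfty_of_def by (rule arg_cong[of _ _ Bcontfun]) auto

lemma linfty_of_diff:
  assumes "bounded (g ` \<Omega>)" "bounded (h ` \<Omega>)"
  shows "linfty_of \<Omega> (\<lambda>t. g t - h t) = linfty_of \<Omega> g - linfty_of \<Omega> h"
  using assms by (intro bcontfun_eqI) (simp add: apply_linfty_of bounded_minus_comp)

lemma linfty_of_add:
  assumes "bounded (g ` \<Omega>)" "bounded (h ` \<Omega>)"
  shows "linfty_of \<Omega> (\<lambda>t. g t + h t) = linfty_of \<Omega> g + linfty_of \<Omega> h"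
  using assms by (intro bcontfun_eqI) (simp add: apply_linfty_of bounded_plus_comp)

lemma linfty_of_mult:
  assumes "bounded (g ` \<Omega>)"
  shows "linfty_of \<Omega> (\<lambda>t. c * g t) = c *\<^sub>C linfty_of \<Omega> g"
proof -
  have "bounded ((\<lambda>t. c * g t) ` \<Omega>)"
    using bounded_linear_image[OF assms bounded_linear_mult_right[of c]] by (simp add: image_image)
  then show ?thesis
    using assms by (intro bcontfun_eqI) (simp add: apply_linfty_of apply_scaleC_bcontfun scaleC_complex_def)
qed

lemma linfty_of_sum:
  assumes "finite Z" "\<And>z. z \<in> Z \<Longrightarrow> bounded (g z ` \<Omega>)"
  shows "bounded ((\<lambda>t. \<Sum>z\<in>Z. c z * g z t) ` \<Omega>) \<and>
    linfty_of \<Omega> (\<lambda>t. \<Sum>z\<in>Z. c z * g z t) = (\<Sum>z\<in>Z. c z *\<^sub>C linfty_of \<Omega> (g z))"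
  using assms
proof (induction Z rule: finite_induct)
  case empty
  have b: "bounded ((\<lambda>_. 0 :: complex) ` \<Omega>)"
    by (auto simp: bounded_iff)
  have "linfty_of \<Omega> (\<lambda>_. 0) = 0"
    using norm_linfty_of_le[of \<Omega> "\<lambda>_. 0" 0] by simp
  with b show ?case by simp
next
  case (insert z Z)
  have "bounded ((\<lambda>t. c z * g z t) ` \<Omega>)"
    using bounded_linear_image[OF _ bounded_linear_mult_right[of "c z"], of "g z ` \<Omega>"] insert.prems
    by (simp add: image_image)
  then show ?case
    using insert by (simp add: bounded_plus_comp linfty_of_add linfty_of_mult)
qed

section \<open>Families of holomorphic functions as vector-valued functions\<close>

text \<open>
  Boundedness is required only locally because this is what partial derivatives inherit: a
  derivative of a bounded holomorphic function may be unbounded near the boundary of \<open>U\<close>.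
\<close>

definition hol_family :: "(complex ^ 'd) set \<Rightarrow> 'w set \<Rightarrow> ('w \<Rightarrow> complex ^ 'd \<Rightarrow> complex) \<Rightarrow> bool" where
  "hol_family U \<Omega> k \<longleftrightarrow> (\<forall>t\<in>\<Omega>. hol U (k t)) \<and>
     (\<forall>z\<in>U. \<exists>r>0. \<exists>C\<ge>0. ball z r \<subseteq> U \<and> (\<forall>w\<in>ball z r. \<forall>t\<in>\<Omega>. norm (k t w) \<le> C))"

lemma hol_familyE:
  assumes "hol_family U \<Omega> k" "z \<in> U"
  obtains r C where "0 < r" "0 \<le> C" "ball z r \<subseteq> U"
    "\<And>w t. w \<in> ball z r \<Longrightarrow> t \<in> \<Omega> \<Longrightarrow> norm (k t w) \<le> C"
  using assms unfolding hol_family_def by meson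

lemma hol_family_hol: "hol_family U \<Omega> k \<Longrightarrow> t \<in> \<Omega> \<Longrightarrow> hol U (k t)"
  by (simp add: hol_family_def)

lemma hol_family_bounded:
  assumes "hol_family U \<Omega> k" "z \<in> U"
  shows "bounded ((\<lambda>t. k t z) ` \<Omega>)"
proof -
  obtain r C where "0 < r" "\<And>w t. w \<in> ball z r \<Longrightarrow> t \<in> \<Omega> \<Longrightarrow> norm (k t w) \<le> C"
    using hol_familyE[OF assms] by metis
  then have "norm (k t z) \<le> C" if "t \<in> \<Omega>" for t
    using that by simp
  then show ?thesis
    by (auto simp: bounded_iff)
qed

lemma hol_family_cong:
  assumes U: "open U" and k: "hol_family U \<Omega> k"
    and eq: "\<And>t z. t \<in> \<Omega> \<Longrightarrow> z \<in> U \<Longrightarrow> k t z = l t z"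
  shows "hol_family U \<Omega> l"
  unfolding hol_family_def
proof (intro conjI ballI)
  show "hol U (l t)" if "t \<in> \<Omega>" for t
    using hol_cong[OF U hol_family_hol[OF k that]] eq that by blast
  fix z assume "z \<in> U"
  then obtain r C where *: "0 < r" "0 \<le> C" "ball z r \<subseteq> U"
    "\<And>w t. w \<in> ball z r \<Longrightarrow> t \<in> \<Omega> \<Longrightarrow> norm (k t w) \<le> C"
    using hol_familyE[OF k] by metis
  then have "norm (l t w) \<le> C" if "w \<in> ball z r" "t \<in> \<Omega>" for w t
    using that eq[of t w] by (metis subsetD)
  with * show "\<exists>r>0. \<exists>C\<ge>0. ball z r \<subseteq> U \<and> (\<forall>w\<in>ball z r. \<forall>t\<in>\<Omega>. norm (l t w) \<le> C)"
    by blast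
qed

text \<open>
  The Cauchy inequality on balls of half the radius bounds the derivatives uniformly in \<open>t\<close>.
\<close>

lemma hol_family_directional_derivative:
  assumes U: "open U" and k: "hol_family U \<Omega> k"
  shows "hol_family U \<Omega> (\<lambda>t z. fderiv (k t) z v)"
  unfolding hol_family_def
proof (intro conjI ballI)
  show "hol U (\<lambda>z. fderiv (k t) z v)" if "t \<in> \<Omega>" for t
    using hol_directional_derivative[OF U hol_family_hol[OF k that]] .
  fix z assume "z \<in> U"
  then obtain r C where r: "0 < r" and C: "0 \<le> C" and sub: "ball z r \<subseteq> U"
    and bd: "\<And>w t. w \<in> ball z r \<Longrightarrow> t \<in> \<Omega> \<Longrightarrow> norm (k t w) \<le> C"
    using hol_familyE[OF k] by metis
  have "norm (fderiv (k t) w v) \<le> 2 * C / (r / 2) * norm v"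
    if w: "w \<in> ball z (r / 2)" and t: "t \<in> \<Omega>" for w t
  proof (rule hol_Cauchy_deriv[OF hol_family_hol[OF k t]])
    have "ball w (r / 2) \<subseteq> ball z r"
    proof
      fix y assume "y \<in> ball w (r / 2)"
      then show "y \<in> ball z r"
        using w dist_triangle[of z y w] by simp
    qed
    then show "ball w (r / 2) \<subseteq> U" "\<And>y. y \<in> ball w (r / 2) \<Longrightarrow> norm (k t y) \<le> C"
      using sub bd t by blast+
  qed (use r in simp)
  moreover have "ball z (r / 2) \<subseteq> U"
    using sub subset_ball[of "r / 2" r z] r by auto
  ultimately show "\<exists>r>0. \<exists>C\<ge>0. ball z r \<subseteq> U \<and> (\<forall>w\<in>ball z r. \<forall>t\<in>\<Omega>. norm (fderiv (k t) w v) \<le> C)"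
    using r C by (intro exI[of _ "r / 2"] exI[of _ "2 * C / (r / 2) * norm v"] conjI) auto
qed

text \<open>
  The quadratic remainder bound is the same for all \<open>t\<close>, hence holds in the supremum norm.
\<close>

lemma hol_family_has_derivative:
  fixes k :: "'w \<Rightarrow> complex ^ 'd \<Rightarrow> complex"
  assumes U: "open U" and k: "hol_family U \<Omega> k" and z: "z \<in> U"
  defines "L \<equiv> \<lambda>h. linfty_of \<Omega> (\<lambda>t. fderiv (k t) z h)"
  shows "((\<lambda>z. linfty_of \<Omega> (\<lambda>t. k t z)) has_derivative L) (at z)"
    and "Vector_Spaces.linear (*s) (*\<^sub>C) L"
proof -
  obtain r C where r: "0 < r" and C: "0 \<le> C" and sub: "ball z r \<subseteq> U"
    and bd: "\<And>w t. w \<in> ball z r \<Longrightarrow> t \<in> \<Omega> \<Longrightarrow> norm (k t w) \<le> C"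
    using hol_familyE[OF k z] by metis
  have bdd: "bounded ((\<lambda>t. fderiv (k t) z h) ` \<Omega>)" for h
    using hol_family_bounded[OF hol_family_directional_derivative[OF U k] z] .
  have L_add: "L (x + y) = L x + L y" for x y
  proof -
    have "L (x + y) = linfty_of \<Omega> (\<lambda>t. fderiv (k t) z x + fderiv (k t) z y)"
      unfolding L_def by (intro linfty_of_cong hol_deriv(3)[OF hol_family_hol[OF k] z])
    then show ?thesis
      by (simp add: L_def linfty_of_add bdd)
  qed
  have L_smult: "L (c *s x) = c *\<^sub>C L x" for c x
  proof -
    have "L (c *s x) = linfty_of \<Omega> (\<lambda>t. c * fderiv (k t) z x)"
      unfolding L_def by (intro linfty_of_cong hol_deriv(2)[OF hol_family_hol[OF k] z])
    then show ?thesis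
      by (simp add: L_def linfty_of_mult bdd)
  qed
  show "Vector_Spaces.linear (*s) (*\<^sub>C) L"
    using L_add L_smult by (rule linear_smult_scaleCI)
  have "linear L"
    by (rule linearI) (simp_all add: L_add L_smult scaleR_eq_smult scaleC_complex_of_real)
  then have L: "bounded_linear L"
    by (simp add: linear_conv_bounded_linear)
  show "((\<lambda>z. linfty_of \<Omega> (\<lambda>t. k t z)) has_derivative L) (at z)"
  proof (rule has_derivative_if_quadratic_remainder[OF L])
    show "0 < r / 4" using r by simp
    fix h :: "complex ^ 'd"
    assume h: "norm h \<le> r / 4"
    then have zh: "z + h \<in> U"
      using sub r by (auto simp: dist_norm)
    note bds = hol_family_bounded[OF k zh] hol_family_bounded[OF k z]
    have "linfty_of \<Omega> (\<lambda>t. k t (z + h)) - linfty_of \<Omega> (\<lambda>t. k t z) - L h =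
      linfty_of \<Omega> (\<lambda>t. k t (z + h) - k t z - fderiv (k t) z h)"
      unfolding L_def using bds bdd by (simp add: linfty_of_diff bounded_minus_comp)
    also have "norm \<dots> \<le> 8 * C / r\<^sup>2 * (norm h)\<^sup>2"
      using sub r bd h C by (intro norm_linfty_of_le hol_Cauchy_remainder[OF hol_family_hol[OF k]]) auto
    finally show "norm (linfty_of \<Omega> (\<lambda>t. k t (z + h)) - linfty_of \<Omega> (\<lambda>t. k t z) - L h)
      \<le> 8 * C / r\<^sup>2 * (norm h)\<^sup>2" .
  qed
qed

lemma directional_limit:
  fixes G :: "complex ^ 'd \<Rightarrow> 'e :: complex_normed_vector"
  assumes G: "(G has_derivative L) (at z)" and L: "Vector_Spaces.linear (*s) (*\<^sub>C) L"
  shows "((\<lambda>c. inverse c *\<^sub>C (G (z + c *s v) - G z)) \<longlongrightarrow> L v) (at 0)"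
proof (cases "v = 0")
  case True
  then show ?thesis
    using linear_0[OF has_derivative_linear[OF G]] by simp
next
  case False
  have Ls: "L (c *s x) = c *\<^sub>C L x" for c x
    using L by (simp add: Vector_Spaces.linear_iff)
  let ?q = "\<lambda>h. norm (G (z + h) - G z - L h) / norm h"
  have "filterlim (\<lambda>c. c *s v) (at 0) (at 0)"
    unfolding filterlim_at
  proof
    have "((\<lambda>c. c *s v) \<longlongrightarrow> 0 *s v) (at 0)"
      using bounded_linear.tendsto[OF bounded_linear_line tendsto_ident_at] .
    then show "((\<lambda>c. c *s v) \<longlongrightarrow> 0) (at 0)" by simp
    show "eventually (\<lambda>c. c *s v \<in> UNIV \<and> c *s v \<noteq> 0) (at 0)"
      using False by (auto simp: eventually_at_filter)
  qed
  then have "((\<lambda>c. ?q (c *s v)) \<longlongrightarrow> 0) (at 0)"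
    using G filterlim_compose[of ?q "nhds 0" "at 0"] unfolding has_derivative_at by fast
  then have lim: "((\<lambda>c. norm v * ?q (c *s v)) \<longlongrightarrow> 0) (at 0)"
    using tendsto_mult_right_zero by blast
  have eq: "norm (inverse c *\<^sub>C (G (z + c *s v) - G z) - L v) = norm v * ?q (c *s v)"
    if "c \<noteq> 0" for c
  proof -
    have "inverse c *\<^sub>C (G (z + c *s v) - G z) - L v
      = inverse c *\<^sub>C (G (z + c *s v) - G z - L (c *s v))"
      using that by (simp add: Ls complex_vector.scale_right_diff_distrib)
    then show ?thesis
      using that False by (simp add: norm_scaleC norm_inverse norm_divide norm_vector_smult divide_simps)
  qed
  have "eventually (\<lambda>c :: complex. c \<noteq> 0) (at 0)"
    by (simp add: eventually_at_filter)
  then have "eventually (\<lambda>c. norm v * ?q (c *s v)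
      = norm (inverse c *\<^sub>C (G (z + c *s v) - G z) - L v)) (at 0)"
    by eventually_elim (rule eq[symmetric])
  then have "((\<lambda>c. norm (inverse c *\<^sub>C (G (z + c *s v) - G z) - L v)) \<longlongrightarrow> 0) (at 0)"
    using lim tendsto_cong by fastforce
  then show ?thesis
    by (simp add: tendsto_norm_zero_iff LIM_zero_iff)
qed

lemma eventually_line_in_open:
  fixes z v :: "complex ^ 'd"
  assumes "open U" "z \<in> U"
  shows "eventually (\<lambda>c. z + c *s v \<in> U) (at 0)"
proof -
  have "((\<lambda>c. z + c *s v) \<longlongrightarrow> z + 0 *s v) (at 0)"
    by (rule tendsto_add[OF tendsto_const bounded_linear.tendsto[OF bounded_linear_line tendsto_ident_at]])
  then show ?thesis
    using assms topological_tendstoD by fastforce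
qed

text \<open>
  Directional derivatives are limits of difference quotients, which lie in the subspace.
\<close>

lemma derivative_in_closed_subspace:
  fixes G :: "complex ^ 'd \<Rightarrow> 'e :: complex_normed_vector"
  assumes G: "(G has_derivative L) (at z)" and L: "Vector_Spaces.linear (*s) (*\<^sub>C) L"
    and U: "open U" "z \<in> U" and E: "complex_vector.subspace E" "closed E" "G ` U \<subseteq> E"
  shows "L v \<in> E"
proof (rule Lim_in_closed_set[OF E(2) _ _ directional_limit[OF G L]])
  show "eventually (\<lambda>c. inverse c *\<^sub>C (G (z + c *s v) - G z) \<in> E) (at 0)"
    using eventually_line_in_open[OF U]
    by eventually_elim
      (use U E in \<open>auto intro!: complex_vector.subspace_scale complex_vector.subspace_diff\<close>)
qed simp

section \<open>Continuous linear functionals on a subspace\<close>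

lemma dual_space_linear:
  assumes "\<mu> \<in> dual_space E" "complex_vector.subspace E" "x \<in> E" "y \<in> E"
  shows "\<mu> (x + y) = \<mu> x + \<mu> y" "\<mu> (c *\<^sub>C x) = c * \<mu> x" "\<mu> (x - y) = \<mu> x - \<mu> y"
proof -
  show add: "\<mu> (x + y) = \<mu> x + \<mu> y" and scale: "\<mu> (c *\<^sub>C x) = c * \<mu> x"
    using assms by (auto simp: dual_space_def)
  have "\<mu> (x - y + y) = \<mu> (x - y) + \<mu> y"
    using assms complex_vector.subspace_diff[of E x y] unfolding dual_space_def by blast
  then show "\<mu> (x - y) = \<mu> x - \<mu> y"
    by simp
qed

lemma dual_space_bounded:
  assumes \<mu>: "\<mu> \<in> dual_space E" and E: "complex_vector.subspace E"
  obtains K where "0 \<le> K" "\<And>x. x \<in> E \<Longrightarrow> norm (\<mu> x) \<le> K * norm x"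
proof -
  note lin = dual_space_linear[OF \<mu> E]
  have 0: "0 \<in> E"
    using E complex_vector.subspace_0 by blast
  then have \<mu>0: "\<mu> 0 = 0"
    using lin(1)[of 0 0] by simp
  have "continuous_on E \<mu>"
    using \<mu> by (simp add: dual_space_def)
  then obtain \<delta> where \<delta>: "0 < \<delta>" "\<And>x. x \<in> E \<Longrightarrow> norm x < \<delta> \<Longrightarrow> norm (\<mu> x) < 1"
    using 0 \<mu>0 unfolding continuous_on_iff by (metis dist_0_norm dist_commute zero_less_one)
  have "norm (\<mu> x) \<le> 2 / \<delta> * norm x" if x: "x \<in> E" for x
  proof (cases "x = 0")
    case True
    then show ?thesis using \<mu>0 by simp
  next
    case False
    define a where "a = \<delta> / (2 * norm x)"
    have a: "0 < a"
      using False \<delta> by (simp add: a_def)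
    have "complex_of_real a *\<^sub>C x \<in> E"
      using E x complex_vector.subspace_scale by blast
    moreover have "norm (complex_of_real a *\<^sub>C x) < \<delta>"
      using False \<delta> a by (simp add: norm_scaleC) (simp add: a_def)
    ultimately have "norm (\<mu> (complex_of_real a *\<^sub>C x)) < 1"
      by (rule \<delta>)
    then have "a * norm (\<mu> x) < 1"
      using a by (simp add: lin(2)[OF x x] norm_mult)
    then show ?thesis
      using False \<delta> by (simp add: a_def field_simps)
  qed
  then show ?thesis
    using \<delta> by (intro that[of "2 / \<delta>"]) auto
qed

lemma dual_space_sum:
  assumes \<mu>: "\<mu> \<in> dual_space E" and E: "complex_vector.subspace E"
    and Z: "finite Z" and x: "\<And>z. z \<in> Z \<Longrightarrow> x z \<in> E"
  shows "(\<Sum>z\<in>Z. c z *\<^sub>C x z) \<in> E \<and> \<mu> (\<Sum>z\<in>Z. c z *\<^sub>C x z) = (\<Sum>z\<in>Z. c z * \<mu> (x z))"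
  using Z x
proof (induction Z rule: finite_induct)
  case empty
  have "0 \<in> E"
    using E complex_vector.subspace_0 by blast
  then show ?case
    using dual_space_linear(1)[OF \<mu> E, of 0 0] by simp
next
  case (insert z Z)
  then have "c z *\<^sub>C x z \<in> E" "(\<Sum>z\<in>Z. c z *\<^sub>C x z) \<in> E"
    using E complex_vector.subspace_scale by blast+
  then show ?case
    using insert dual_space_linear[OF \<mu> E] E
    by (simp add: complex_vector.subspace_add)
qed

section \<open>Iterated partial derivatives\<close>

lemma cpartial_eq_directional:
  "cpartial j F z = Lim (at 0) (\<lambda>c. inverse c *\<^sub>C (F (z + c *s axis j 1) - F z))"
proof -
  have "axis j c = c *s axis j (1 :: complex)" for c
    by (simp add: vec_eq_iff axis_def)
  then have "axis j = (\<lambda>c. c *s axis j (1 :: complex))"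
    by (rule ext)
  then show ?thesis
    unfolding cpartial_def by (rule arg_cong)
qed

text \<open>
  It is enough to know the function on the open set, since \<open>cpartial\<close> looks only at points
  near \<open>z\<close>. This makes the rule applicable to iterated derivatives, whose values outside \<open>U\<close> are
  arbitrary.
\<close>

lemma cpartial_eqI:
  fixes H :: "complex ^ 'd \<Rightarrow> 'e :: complex_normed_vector"
  assumes U: "open U" "z \<in> U" and eq: "\<And>w. w \<in> U \<Longrightarrow> H w = G w"
    and G: "(G has_derivative L) (at z)" and L: "Vector_Spaces.linear (*s) (*\<^sub>C) L"
  shows "cpartial j H z = L (axis j 1)"
  unfolding cpartial_eq_directional
proof (rule tendsto_Lim)
  show "((\<lambda>c. inverse c *\<^sub>C (H (z + c *s axis j 1) - H z)) \<longlongrightarrow> L (axis j 1)) (at 0)"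
  proof (rule Lim_transform_eventually[OF directional_limit[OF G L]])
    show "eventually (\<lambda>c. inverse c *\<^sub>C (G (z + c *s axis j 1) - G z)
        = inverse c *\<^sub>C (H (z + c *s axis j 1) - H z)) (at 0)"
      using eventually_line_in_open[OF U, of "axis j 1"] by eventually_elim (simp add: eq U)
  qed
qed simp

lemma cpartial_hol:
  assumes U: "open U" "z \<in> U" and g: "hol U g"
  shows "cpartial j g z = fderiv g z (axis j 1)"
proof (rule cpartial_eqI[OF U refl hol_deriv(1)[OF g U(2)]])
  show "Vector_Spaces.linear (*s) (*\<^sub>C) (fderiv g z)"
    by (rule linear_smult_scaleCI)
      (simp_all add: hol_deriv(2,3)[OF g U(2)] scaleC_complex_def)
qed

text \<open>
  The functional is applied to difference quotients, which stay in \<open>E\<close>, the only place where it is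
  linear and continuous.
\<close>

lemma cpartial_dual_eqI:
  fixes G :: "complex ^ 'd \<Rightarrow> 'e :: complex_normed_vector"
  assumes U: "open U" "z \<in> U" and eq: "\<And>w. w \<in> U \<Longrightarrow> n w = \<mu> (G w)"
    and G: "(G has_derivative L) (at z)" and L: "Vector_Spaces.linear (*s) (*\<^sub>C) L"
    and E: "complex_vector.subspace E" "closed E" "G ` U \<subseteq> E" and \<mu>: "\<mu> \<in> dual_space E"
  shows "cpartial j n z = \<mu> (L (axis j 1))"
  unfolding cpartial_eq_directional
proof (rule tendsto_Lim)
  let ?q = "\<lambda>c. inverse c *\<^sub>C (G (z + c *s axis j 1) - G z)"
  have ev: "eventually (\<lambda>c. z + c *s axis j 1 \<in> U) (at 0)"
    using eventually_line_in_open[OF U] .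
  have inE: "?q c \<in> E" if "z + c *s axis j 1 \<in> U" for c
    using that U E by (auto intro!: complex_vector.subspace_scale complex_vector.subspace_diff)
  have "((\<lambda>c. \<mu> (?q c)) \<longlongrightarrow> \<mu> (L (axis j 1))) (at 0)"
  proof (rule continuous_on_tendsto_compose[OF _ directional_limit[OF G L]])
    show "continuous_on E \<mu>"
      using \<mu> by (simp add: dual_space_def)
    show "L (axis j 1) \<in> E"
      using derivative_in_closed_subspace[OF G L U E] .
    show "eventually (\<lambda>c. ?q c \<in> E) (at 0)"
      using ev by eventually_elim (rule inE)
  qed
  then show "((\<lambda>c. inverse c *\<^sub>C (n (z + c *s axis j 1) - n z)) \<longlongrightarrow> \<mu> (L (axis j 1))) (at 0)"
  proof (rule Lim_transform_eventually)
    show "eventually (\<lambda>c. \<mu> (?q c) = inverse c *\<^sub>C (n (z + c *s axis j 1) - n z)) (at 0)"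
      using ev
    proof eventually_elim
      case (elim c)
      then have "G (z + c *s axis j 1) \<in> E" "G z \<in> E"
        using E(3) U by auto
      then show ?case
        using elim U
        by (simp add: eq dual_space_linear[OF \<mu> E(1)] complex_vector.subspace_diff[OF E(1)]
            scaleC_complex_def)
    qed
  qed
qed simp

text \<open>
  The invariant that carries the induction on the order of differentiation: on \<open>U\<close>, the vector-valued
  function \<open>H\<close> is given by the family \<open>k\<close> and takes values in \<open>E\<close>, and each scalar function
  \<open>n \<mu>\<close> is \<open>\<mu> \<circ> H\<close>. The functions \<open>k t\<close> and \<open>n \<mu>\<close> are kept separately, instead of being defined
  from \<open>H\<close>, so that each of them can be differentiated on its own.
\<close>

definition represents where
  "represents U \<Omega> E H k n \<longleftrightarrow> hol_family U \<Omega> k \<and>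
    (\<forall>z\<in>U. H z = linfty_of \<Omega> (\<lambda>t. k t z) \<and> H z \<in> E \<and> (\<forall>\<mu>\<in>dual_space E. n \<mu> z = \<mu> (H z)))"

lemma represents_cpartial:
  assumes U: "open U" and E: "complex_vector.subspace E" "closed E"
    and R: "represents U \<Omega> E H k n"
  shows "represents U \<Omega> E (cpartial j H) (\<lambda>t. cpartial j (k t)) (\<lambda>\<mu>. cpartial j (n \<mu>))"
proof -
  have k: "hol_family U \<Omega> k" and H: "\<And>z. z \<in> U \<Longrightarrow> H z = linfty_of \<Omega> (\<lambda>t. k t z)"
    and HE: "\<And>z. z \<in> U \<Longrightarrow> H z \<in> E"
    and n: "\<And>z \<mu>. z \<in> U \<Longrightarrow> \<mu> \<in> dual_space E \<Longrightarrow> n \<mu> z = \<mu> (H z)"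
    using R by (auto simp: represents_def)
  let ?G = "\<lambda>z. linfty_of \<Omega> (\<lambda>t. k t z)"
  have GE: "?G ` U \<subseteq> E"
    using H HE by force
  have part: "fderiv (k t) z (axis j 1) = cpartial j (k t) z" if "t \<in> \<Omega>" "z \<in> U" for t z
    using cpartial_hol[OF U that(2) hol_family_hol[OF k that(1)]] by simp
  have "hol_family U \<Omega> (\<lambda>t. cpartial j (k t))"
    by (rule hol_family_cong[OF U hol_family_directional_derivative[OF U k, of "axis j 1"]])
      (rule part)
  moreover have "cpartial j H z = linfty_of \<Omega> (\<lambda>t. cpartial j (k t) z) \<and> cpartial j H z \<in> E \<and>
      (\<forall>\<mu>\<in>dual_space E. cpartial j (n \<mu>) z = \<mu> (cpartial j H z))" if z: "z \<in> U" for z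
  proof -
    note d = hol_family_has_derivative[OF U k z]
    have *: "cpartial j H z = linfty_of \<Omega> (\<lambda>t. fderiv (k t) z (axis j 1))"
      using cpartial_eqI[OF U z H d] by simp
    moreover have "\<dots> = linfty_of \<Omega> (\<lambda>t. cpartial j (k t) z)"
      using part z by (intro linfty_of_cong) simp
    moreover have "\<dots> \<in> E"
      using derivative_in_closed_subspace[OF d U z E GE, of "axis j 1"] calculation by simp
    moreover have "cpartial j (n \<mu>) z = \<mu> (cpartial j H z)" if \<mu>: "\<mu> \<in> dual_space E" for \<mu>
      using cpartial_dual_eqI[OF U z _ d E GE \<mu>, of "n \<mu>" j] n[OF _ \<mu>] H * by simp
    ultimately show ?thesis by simp
  qed
  ultimately show ?thesis
    unfolding represents_def by blast
qed

lemma represents_cD: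
  assumes U: "open U" and E: "complex_vector.subspace E" "closed E"
    and R: "represents U \<Omega> E H k n"
  shows "represents U \<Omega> E (cD \<alpha> H) (\<lambda>t. cD \<alpha> (k t)) (\<lambda>\<mu>. cD \<alpha> (n \<mu>))"
proof -
  have pow: "represents U \<Omega> E ((cpartial j ^^ m) H) (\<lambda>t. (cpartial j ^^ m) (k t)) (\<lambda>\<mu>. (cpartial j ^^ m) (n \<mu>))"
    if "represents U \<Omega> E H k n" for j m H k n
    using that by (induction m) (simp_all add: represents_cpartial[OF U E])
  have "represents U \<Omega> E (foldr (\<lambda>j. cpartial j ^^ (\<alpha> $ j)) js H)
      (\<lambda>t. foldr (\<lambda>j. cpartial j ^^ (\<alpha> $ j)) js (k t))
      (\<lambda>\<mu>. foldr (\<lambda>j. cpartial j ^^ (\<alpha> $ j)) js (n \<mu>))" for js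
    using R by (induction js) (simp_all add: pow)
  then show ?thesis
    unfolding cD_def .
qed

section \<open>A finite Hahn-Banach argument\<close>

text \<open>
  Functions with pointwise operations are used, rather than a type of vectors, because the bounded
  holomorphic functions on \<open>U\<close> and their subspaces of functions vanishing at given points do not form
  types.
\<close>

definition function_space :: "('a \<Rightarrow> complex) set \<Rightarrow> bool" where
  "function_space V \<longleftrightarrow> (\<lambda>_. 0) \<in> V \<and> (\<forall>g\<in>V. \<forall>h\<in>V. (\<lambda>x. g x + h x) \<in> V) \<and>
     (\<forall>c. \<forall>g\<in>V. (\<lambda>x. c * g x) \<in> V)"

definition functional_on :: "('a \<Rightarrow> complex) set \<Rightarrow> (('a \<Rightarrow> complex) \<Rightarrow> complex) \<Rightarrow> bool" where
  "functional_on V \<phi> \<longleftrightarrow> (\<forall>g\<in>V. \<forall>h\<in>V. \<phi> (\<lambda>x. g x + h x) = \<phi> g + \<phi> h) \<and>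
     (\<forall>c. \<forall>g\<in>V. \<phi> (\<lambda>x. c * g x) = c * \<phi> g)"

definition seminorm_on :: "('a \<Rightarrow> complex) set \<Rightarrow> (('a \<Rightarrow> complex) \<Rightarrow> real) \<Rightarrow> bool" where
  "seminorm_on V p \<longleftrightarrow> (\<forall>g\<in>V. \<forall>h\<in>V. p (\<lambda>x. g x + h x) \<le> p g + p h) \<and>
     (\<forall>c. \<forall>g\<in>V. p (\<lambda>x. c * g x) = norm c * p g)"

text \<open>
  The set of pairs \<open>(\<phi> g, g x)\<close> with \<open>p g < 1\<close> is convex and invariant under multiplication by
  unimodular scalars, and it does not contain \<open>(1, 0)\<close> by hypothesis. A separating hyperplane gives
  \<open>u\<close> and \<open>v\<close> with \<open>Re (u \<phi>(g) + v g(x)) \<le> Re u\<close> for these \<open>g\<close>, hence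
  \<open>\<bar>u \<phi>(g) + v g(x)\<bar> \<le> Re u p(g)\<close> for all \<open>g\<close>. If \<open>u \<noteq> 0\<close>, division by \<open>u\<close> gives
  \<open>c = - v / u\<close>; if \<open>u = 0\<close>, then all \<open>g\<close> vanish at \<open>x\<close>.
\<close>

lemma functional_on_dominated_at_point:
  assumes V: "function_space V" and \<phi>: "functional_on V \<phi>" and p: "seminorm_on V p"
    and dom: "\<And>g. g \<in> V \<Longrightarrow> g x = 0 \<Longrightarrow> norm (\<phi> g) \<le> p g"
  shows "\<exists>c. \<forall>g\<in>V. norm (\<phi> g - c * g x) \<le> p g"
proof -
  note [simp] = V[unfolded function_space_def, THEN conjunct1]
    V[unfolded function_space_def, THEN conjunct2, THEN conjunct1, rule_format]
    V[unfolded function_space_def, THEN conjunct2, THEN conjunct2, rule_format]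
  have \<phi>_add: "\<phi> (\<lambda>x. g x + h x) = \<phi> g + \<phi> h" and \<phi>_mult: "\<phi> (\<lambda>x. c * g x) = c * \<phi> g"
    and p_add: "p (\<lambda>x. g x + h x) \<le> p g + p h" and p_mult: "p (\<lambda>x. c * g x) = norm c * p g"
    if "g \<in> V" "h \<in> V" for g h c
    using \<phi> p that by (auto simp: functional_on_def seminorm_on_def)
  have zero: "\<phi> (\<lambda>_. 0) = 0" "p (\<lambda>_. 0) = 0"
    using \<phi>_mult[of "\<lambda>_. 0" "\<lambda>_. 0" 0] p_mult[of "\<lambda>_. 0" "\<lambda>_. 0" 0] by simp_all
  have p_nonneg: "0 \<le> p g" if "g \<in> V" for g
    using p_add[of g "\<lambda>x. - 1 * g x"] p_mult[OF that that, of "- 1"] zero that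
      V[unfolded function_space_def, THEN conjunct2, THEN conjunct2, rule_format, of g "- 1"] by simp
  \<comment> \<open>The open condition \<open>p g < 1\<close> keeps \<open>(1, 0)\<close> out, as \<open>p\<close> may equal 1 at some \<open>g\<close> with
    \<open>\<phi> g = 1\<close> and \<open>g x = 0\<close>.\<close>
  define S where "S = (\<lambda>g. (\<phi> g, g x)) ` {g \<in> V. p g < 1}"
  have "convex S"
  proof (rule convexI)
    fix a b and u v :: real
    assume ab: "a \<in> S" "b \<in> S" and uv: "0 \<le> u" "0 \<le> v" "u + v = 1"
    then obtain g h where gh: "g \<in> V" "p g < 1" "a = (\<phi> g, g x)" "h \<in> V" "p h < 1" "b = (\<phi> h, h x)"
      by (auto simp: S_def)
    let ?k = "\<lambda>x. of_real u * g x + of_real v * h x"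
    have "p ?k \<le> p (\<lambda>x. of_real u * g x) + p (\<lambda>x. of_real v * h x)"
      using gh by (intro p_add) simp_all
    also have "\<dots> = u * p g + v * p h"
      using gh uv p_mult by simp
    also have "\<dots> < 1"
      using gh uv by (smt (verit) mult_left_mono mult_cancel_left1 mult_strict_left_mono)
    finally have "p ?k < 1" .
    moreover have "u *\<^sub>R a + v *\<^sub>R b = (\<phi> ?k, ?k x)"
      using gh by (simp add: \<phi>_add \<phi>_mult scaleR_conv_of_real)
    moreover have "?k \<in> V"
      using gh by simp
    ultimately show "u *\<^sub>R a + v *\<^sub>R b \<in> S"
      unfolding S_def by blast
  qed
  moreover have "S \<noteq> {}"
    using zero by (auto simp: S_def intro!: exI[of _ "\<lambda>_. 0"])
  moreover have "S \<inter> {(1, 0)} = {}"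
    using dom by (fastforce simp: S_def)
  ultimately obtain a b where ab: "a \<noteq> 0" "\<forall>y\<in>S. inner a y \<le> b" "\<forall>y\<in>{(1, 0)}. b \<le> inner a y"
    using separating_hyperplane_sets[of S "{(1, 0)}"] by auto
  \<comment> \<open>The real inner product on \<open>\<complex>\<^sup>2\<close> is the real part of a complex linear form.\<close>
  define u v where "u = cnj (fst a)" and "v = cnj (snd a)"
  have uv: "u \<noteq> 0 \<or> v \<noteq> 0"
    using ab(1) by (auto simp: u_def v_def prod_eq_iff)
  define W where "W g = u * \<phi> g + v * g x" for g
  have re: "Re (W g) \<le> Re u" if "g \<in> V" "p g < 1" for g
  proof -
    have "inner a (\<phi> g, g x) \<le> inner a (1, 0)"
      using ab that by (force simp: S_def)
    then show ?thesis
      by (simp add: inner_prod_def inner_complex_def W_def u_def v_def)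
  qed
  have W_mult: "W (\<lambda>x. c * g x) = c * W g" if "g \<in> V" for c g
    using that by (simp add: W_def \<phi>_mult algebra_simps)
  have W_unit: "norm (W g) \<le> Re u" if g: "g \<in> V" "p g < 1" for g
  proof (cases "W g = 0")
    case True
    then show ?thesis
      using re[of "\<lambda>_. 0"] zero by (simp add: W_def)
  next
    case False
    \<comment> \<open>Rotating \<open>g\<close> by this scalar makes \<open>W\<close> real and non-negative.\<close>
    define c where "c = cnj (W g) / of_real (norm (W g))"
    have c: "norm c = 1" "c * W g = of_real (norm (W g))"
      using False by (simp_all add: c_def norm_divide complex_norm_square[symmetric] power2_eq_square mult.commute)
    have "Re (W (\<lambda>x. c * g x)) \<le> Re u"
      using g c by (intro re) (simp_all add: p_mult)
    then show ?thesis
      by (simp add: W_mult g c)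
  qed
  have u_nonneg: "0 \<le> Re u"
    using W_unit[of "\<lambda>_. 0"] zero by (simp add: W_def)
  have W: "norm (W g) \<le> Re u * p g" if g: "g \<in> V" for g
  proof (rule field_le_epsilon)
    fix e :: real assume e: "0 < e"
    define s where "s = p g + e / (Re u + 1)"
    have s: "0 < s" "p g < s"
      using e u_nonneg p_nonneg[OF g] by (auto simp: s_def intro: add_nonneg_pos)
    define b where "b = complex_of_real (inverse s)"
    have b: "norm b = inverse s"
      using s by (simp add: b_def norm_inverse)
    have "norm (W (\<lambda>x. b * g x)) \<le> Re u"
      using s(2) g pos_divide_less_eq[OF s(1), of "p g" 1]
      by (intro W_unit) (simp_all add: p_mult b divide_inverse mult.commute)
    then have "norm (W g) \<le> Re u * s"
      using s by (simp add: W_mult[OF g] norm_mult b field_simps)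
    also have "\<dots> \<le> Re u * p g + e"
      using e u_nonneg by (simp add: s_def field_simps)
    finally show "norm (W g) \<le> Re u * p g + e" .
  qed
  show ?thesis
  proof (cases "u = 0")
    case True
    then have "g x = 0" if "g \<in> V" for g
      using W[OF that] uv by (simp add: W_def)
    then show ?thesis
      using dom by (intro exI[of _ 0]) simp
  next
    case False
    have "norm (\<phi> g - (- v / u) * g x) \<le> p g" if g: "g \<in> V" for g
    proof -
      have "norm u * norm (\<phi> g - (- v / u) * g x) = norm (W g)"
        using False by (simp add: W_def norm_mult[symmetric] algebra_simps)
      also have "\<dots> \<le> Re u * p g"
        using W[OF g] .
      also have "\<dots> \<le> norm u * p g"
        using p_nonneg[OF g] complex_Re_le_cmod by (rule mult_right_mono[rotated])
      finally show ?thesis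
        using False by simp
    qed
    then show ?thesis by blast
  qed
qed

text \<open>
  The previous lemma removes the points one at a time: the induction hypothesis is used on the subspace
  of functions that vanish at the new point \<open>x\<close>, and the functional
  \<open>\<phi> - \<Sum> c\<^sub>z \<delta>\<^sub>z\<close> obtained there is then corrected by a multiple of the evaluation at \<open>x\<close>. The
  bound \<open>p\<close> does not deteriorate in the process, so the number of points is irrelevant.
\<close>

lemma functional_on_near_evaluations:
  assumes "finite Z" "function_space V" "functional_on V \<phi>" "seminorm_on V p"
    and "\<And>g. g \<in> V \<Longrightarrow> (\<forall>z\<in>Z. g z = 0) \<Longrightarrow> norm (\<phi> g) \<le> p g"
  shows "\<exists>c. \<forall>g\<in>V. norm (\<phi> g - (\<Sum>z\<in>Z. c z * g z)) \<le> p g"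
  using assms
proof (induction Z arbitrary: V rule: finite_induct)
  case empty
  then show ?case by simp
next
  case (insert x Z)
  define V' where "V' = {g \<in> V. g x = 0}"
  have "\<exists>c. \<forall>g\<in>V'. norm (\<phi> g - (\<Sum>z\<in>Z. c z * g z)) \<le> p g"
  proof (rule insert.IH)
    show "function_space V'"
      using insert.prems(1) by (auto simp: V'_def function_space_def)
    show "functional_on V' \<phi>" "seminorm_on V' p"
      using insert.prems(2,3) by (auto simp: V'_def functional_on_def seminorm_on_def)
    show "norm (\<phi> g) \<le> p g" if "g \<in> V'" "\<forall>z\<in>Z. g z = 0" for g
      using that by (intro insert.prems(4)) (auto simp: V'_def)
  qed
  then obtain c where c: "\<And>g. g \<in> V' \<Longrightarrow> norm (\<phi> g - (\<Sum>z\<in>Z. c z * g z)) \<le> p g"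
    by blast
  have "\<exists>d. \<forall>g\<in>V. norm ((\<phi> g - (\<Sum>z\<in>Z. c z * g z)) - d * g x) \<le> p g"
  proof (rule functional_on_dominated_at_point[OF insert.prems(1) _ insert.prems(3)])
    show "functional_on V (\<lambda>g. \<phi> g - (\<Sum>z\<in>Z. c z * g z))"
      using insert.prems(2)
      by (auto simp: functional_on_def algebra_simps sum.distrib sum_distrib_left)
  qed (use c in \<open>auto simp: V'_def\<close>)
  then obtain d where d: "\<And>g. g \<in> V \<Longrightarrow> norm ((\<phi> g - (\<Sum>z\<in>Z. c z * g z)) - d * g x) \<le> p g"
    by blast
  have "norm (\<phi> g - (\<Sum>z\<in>insert x Z. (c(x := d)) z * g z)) \<le> p g" if "g \<in> V" for g
  proof -
    have "(\<Sum>z\<in>Z. (c(x := d)) z * g z) = (\<Sum>z\<in>Z. c z * g z)"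
      using insert.hyps by (intro sum.cong) auto
    then show ?thesis
      using d[OF that] insert.hyps by (simp add: algebra_simps)
  qed
  then show ?case by blast
qed

section \<open>Functionals continuous under bounded pointwise convergence\<close>

text \<open>
  The abbreviation fixes the type of \<open>UNIV\<close>, which the carrier notation leaves open.
\<close>

abbreviation Hinf_scalar :: "(complex ^ 'd) set \<Rightarrow> (complex ^ 'd \<Rightarrow> complex) set" where
  "Hinf_scalar U \<equiv> Hinf U UNIV"

lemma Hinf_UNIV: "g \<in> Hinf_scalar U \<longleftrightarrow> hol U g \<and> bounded (g ` U)"
  by (simp add: Hinf_def)

lemma function_space_Hinf: "function_space (Hinf_scalar U)"
  unfolding function_space_def
proof (intro conjI ballI allI)
  have "hol U (\<lambda>_. 0)"
    by (rule holI) (auto intro!: exI[of _ "\<lambda>_. 0"])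
  then show "(\<lambda>_. 0) \<in> Hinf_scalar U"
    by (auto simp: Hinf_UNIV bounded_iff)
next
  fix g h assume "g \<in> Hinf_scalar U" "h \<in> Hinf_scalar U"
  then have g: "hol U g" "bounded (g ` U)" and h: "hol U h" "bounded (h ` U)"
    by (simp_all add: Hinf_UNIV)
  have "hol U (\<lambda>x. g x + h x)"
  proof (rule holI)
    fix z assume z: "z \<in> U"
    show "\<exists>L. ((\<lambda>x. g x + h x) has_derivative L) (at z) \<and> (\<forall>c h. L (c *s h) = c * L h)"
      using has_derivative_add[OF hol_deriv(1)[OF g(1) z] hol_deriv(1)[OF h(1) z]]
      by (intro exI[of _ "\<lambda>x. fderiv g z x + fderiv h z x"])
        (simp add: hol_deriv(2)[OF g(1) z] hol_deriv(2)[OF h(1) z] algebra_simps)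
  qed
  then show "(\<lambda>x. g x + h x) \<in> Hinf_scalar U"
    using g h by (simp add: Hinf_UNIV bounded_plus_comp)
next
  fix c g assume "g \<in> Hinf_scalar U"
  then have g: "hol U g" "bounded (g ` U)"
    by (simp_all add: Hinf_UNIV)
  have "hol U (\<lambda>x. c * g x)"
  proof (rule holI)
    fix z assume z: "z \<in> U"
    show "\<exists>L. ((\<lambda>x. c * g x) has_derivative L) (at z) \<and> (\<forall>c h. L (c *s h) = c * L h)"
      using has_derivative_mult_right[OF hol_deriv(1)[OF g(1) z], of c]
      by (intro exI[of _ "\<lambda>x. c * fderiv g z x"]) (simp add: hol_deriv(2)[OF g(1) z])
  qed
  moreover have "bounded ((\<lambda>x. c * g x) ` U)"
    using bounded_linear_image[OF g(2) bounded_linear_mult_right[of c]] by (simp add: image_image)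
  ultimately show "(\<lambda>x. c * g x) \<in> Hinf_scalar U"
    by (simp add: Hinf_UNIV)
qed

text \<open>
  Linearity and boundedness of \<open>\<mu>\<close> are known on \<open>E\<close> only, so instead of the chain rule for bounded
  linear maps, the remainder is estimated inside \<open>E\<close>.
\<close>

lemma Hinf_dual:
  assumes F: "F \<in> Hinf U E" and U: "open U" and E: "complex_vector.subspace E" and \<mu>: "\<mu> \<in> dual_space E"
  shows "(\<lambda>z. \<mu> (F z)) \<in> Hinf_scalar U"
proof -
  obtain K where K: "0 \<le> K" "\<And>x. x \<in> E \<Longrightarrow> norm (\<mu> x) \<le> K * norm x"
    using dual_space_bounded[OF \<mu> E] by metis
  have FE: "F z \<in> E" if "z \<in> U" for z
    using F that by (auto simp: Hinf_def holomorphic_into_def)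
  note lin = dual_space_linear[OF \<mu> E]
  have "hol U (\<lambda>z. \<mu> (F z))"
  proof (rule holI)
    fix z assume z: "z \<in> U"
    then obtain L where L: "(F has_derivative L) (at z)" "range L \<subseteq> E" "Vector_Spaces.linear (*s) (*\<^sub>C) L"
      using F by (auto simp: Hinf_def holomorphic_into_def)
    have LE: "L h \<in> E" for h
      using L(2) by auto
    have L_add: "L (h + h') = L h + L h'" and L_mult: "L (c *s h) = c *\<^sub>C L h" for h h' c
      using L(3) by (auto simp: Vector_Spaces.linear_iff)
    have "linear (\<lambda>h. \<mu> (L h))"
      by (rule linearI)
        (simp_all add: L_add L_mult lin(1,2)[OF LE LE] scaleR_eq_smult scaleR_conv_of_real)
    then have bl: "bounded_linear (\<lambda>h. \<mu> (L h))"
      by (simp add: linear_conv_bounded_linear)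
    have lim: "((\<lambda>h. K * (norm (F (z + h) - F z - L h) / norm h)) \<longlongrightarrow> 0) (at 0)"
      using L(1) tendsto_mult_right_zero unfolding has_derivative_at by blast
    have "((\<lambda>z. \<mu> (F z)) has_derivative (\<lambda>h. \<mu> (L h))) (at z)"
      unfolding has_derivative_at
    proof (intro conjI bl)
      have "eventually (\<lambda>h. z + h \<in> U) (at 0)"
      proof -
        have "((\<lambda>h. z + h) \<longlongrightarrow> z + 0) (at 0)"
          by (rule tendsto_add[OF tendsto_const tendsto_ident_at])
        then show ?thesis
          using U z topological_tendstoD by fastforce
      qed
      then have "eventually (\<lambda>h. norm (norm (\<mu> (F (z + h)) - \<mu> (F z) - \<mu> (L h)) / norm h)
          \<le> K * (norm (F (z + h) - F z - L h) / norm h)) (at 0)"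
      proof eventually_elim
        case (elim h)
        have d: "F (z + h) - F z \<in> E"
          using FE elim z E complex_vector.subspace_diff by blast
        then have "F (z + h) - F z - L h \<in> E"
          using LE E complex_vector.subspace_diff by blast
        then have "norm (\<mu> (F (z + h)) - \<mu> (F z) - \<mu> (L h)) \<le> K * norm (F (z + h) - F z - L h)"
          using K(2)[of "F (z + h) - F z - L h"] lin(3)[OF FE[OF elim] FE[OF z]] lin(3)[OF d LE] by simp
        then show ?case
          by (simp add: divide_right_mono)
      qed
      then show "((\<lambda>h. norm (\<mu> (F (z + h)) - \<mu> (F z) - \<mu> (L h)) / norm h) \<longlongrightarrow> 0) (at 0)"
        using lim by (rule Lim_null_comparison)
    qed
    then show "\<exists>L. ((\<lambda>z. \<mu> (F z)) has_derivative L) (at z) \<and> (\<forall>c h. L (c *s h) = c * L h)"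
      by (intro exI[of _ "\<lambda>h. \<mu> (L h)"]) (simp add: L_mult lin(2)[OF LE LE])
  qed
  moreover have "bounded ((\<lambda>z. \<mu> (F z)) ` U)"
  proof -
    obtain B where B: "\<And>z. z \<in> U \<Longrightarrow> norm (F z) \<le> B"
      using F unfolding Hinf_def bounded_iff by blast
    have "norm (\<mu> (F z)) \<le> K * B" if "z \<in> U" for z
      using K(2)[OF FE[OF that]] mult_left_mono[OF B[OF that] K(1)] by linarith
    then show ?thesis
      unfolding bounded_iff by blast
  qed
  ultimately show ?thesis
    by (simp add: Hinf_UNIV)
qed

text \<open>
  Otherwise there are \<open>g\<^sub>n\<close> in the unit ball that vanish at the first \<open>n\<close> points of a dense sequence
  and satisfy \<open>\<bar>\<phi>(g\<^sub>n)\<bar> > \<epsilon>\<close>. By equicontinuity, \<open>g\<^sub>n\<close> tends to 0 at every point of \<open>U\<close>, so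
  bp-continuity forces \<open>\<phi>(g\<^sub>n)\<close> to tend to 0.
\<close>

lemma bp_continuous_small_if_vanishing:
  assumes U: "open U" "U \<noteq> {}" and \<phi>: "linear_functional_Hinf U \<phi>" "bp_continuous U \<phi>"
    and \<epsilon>: "0 < \<epsilon>"
  shows "\<exists>Z. finite Z \<and> Z \<subseteq> U \<and> (\<forall>g\<in>Hinf_scalar U. (\<forall>z\<in>U. norm (g z) \<le> 1) \<longrightarrow>
    (\<forall>z\<in>Z. g z = 0) \<longrightarrow> norm (\<phi> g) \<le> \<epsilon>)"
proof (rule ccontr)
  assume neg: "\<not> ?thesis"
  obtain D :: "(complex ^ 'a) set" where D: "countable D" "\<And>X. open X \<Longrightarrow> X \<noteq> {} \<Longrightarrow> \<exists>d\<in>D. d \<in> X"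
    by (rule countable_dense_setE) blast
  define d where "d = from_nat_into (D \<inter> U)"
  have ne: "D \<inter> U \<noteq> {}"
    using D(2)[OF U] by blast
  have range_d: "range d = D \<inter> U"
    unfolding d_def using range_from_nat_into[OF ne] D(1) by simp
  have "\<exists>g\<in>Hinf_scalar U. (\<forall>z\<in>U. norm (g z) \<le> 1) \<and> (\<forall>m\<le>n. g (d m) = 0) \<and> \<epsilon> < norm (\<phi> g)" for n
  proof -
    have "finite (d ` {..n})" "d ` {..n} \<subseteq> U"
      using range_d by auto
    then show ?thesis
      using neg[simplified, rule_format, of "d ` {..n}"] by (auto simp: not_le)
  qed
  then obtain g where g: "\<And>n. g n \<in> Hinf_scalar U" "\<And>n z. z \<in> U \<Longrightarrow> norm (g n z) \<le> 1"
    and g0: "\<And>n m. m \<le> n \<Longrightarrow> g n (d m) = 0" and g\<phi>: "\<And>n. \<epsilon> < norm (\<phi> (g n))"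
    by metis
  have zero: "(\<lambda>_. 0) \<in> Hinf_scalar U"
    using function_space_Hinf[of U] by (simp add: function_space_def)
  have "(\<lambda>n. g n z) \<longlonglongrightarrow> 0" if z: "z \<in> U" for z
  proof (rule LIMSEQ_I)
    fix e :: real assume e: "0 < e"
    obtain r where r: "0 < r" "ball z r \<subseteq> U"
      using U z open_contains_ball by blast
    \<comment> \<open>Within distance \<open>s\<close> of \<open>z\<close>, the Lipschitz constant \<open>4 / r\<close> makes \<open>g n\<close> vary by less than
      \<open>e\<close>.\<close>
    define s where "s = min (r / 4) (e * r / 4)"
    have s: "0 < s"
      using r e by (simp add: s_def)
    then obtain y where "y \<in> D" "y \<in> ball z s"
      using D(2)[of "ball z s"] by auto
    moreover have "ball z s \<subseteq> ball z r"
      using r by (intro subset_ball) (simp add: s_def)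
    ultimately obtain m where m: "d m \<in> ball z s"
      using r range_d by (metis IntI rangeE subsetD)
    have "norm (g n z - 0) < e" if "m \<le> n" for n
    proof -
      define h where "h = d m - z"
      have h: "norm h < s"
        using m by (simp add: h_def dist_norm norm_minus_commute)
      have "norm (g n (z + h) - g n z) \<le> 4 * 1 / r * norm h"
        using g r h by (intro hol_Lipschitz[of U]) (auto simp: Hinf_UNIV s_def)
      also have "\<dots> = 4 / r * norm h"
        by simp
      also have "\<dots> < 4 / r * s"
        using h r by (intro mult_strict_left_mono) auto
      also have "\<dots> \<le> 4 / r * (e * r / 4)"
        using r by (intro mult_left_mono) (auto simp: s_def)
      also have "\<dots> = e"
        using r by simp
      finally show ?thesis
        using g0[OF that] by (simp add: h_def)
    qed
    then show "\<exists>no. \<forall>n\<ge>no. norm (g n z - 0) < e"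
      by blast
  qed
  then have "bp_converges U g (\<lambda>_. 0)"
    using g(2) by (auto simp: bp_converges_def)
  then have lim: "(\<lambda>n. \<phi> (g n)) \<longlonglongrightarrow> \<phi> (\<lambda>_. 0)"
    using \<phi>(2) g(1) zero by (simp add: bp_continuous_def)
  have "\<phi> (\<lambda>_. 0 * 0) = 0 * \<phi> (\<lambda>_. 0)"
    using \<phi>(1)[unfolded linear_functional_Hinf_def, THEN conjunct2, THEN conjunct2,
        rule_format, OF zero, of 0] .
  then have "(\<lambda>n. norm (\<phi> (g n))) \<longlonglongrightarrow> 0"
    using tendsto_norm[OF lim] by simp
  moreover have "\<exists>N. \<forall>n\<ge>N. \<epsilon> \<le> norm (\<phi> (g n))"
    by (intro exI allI impI less_imp_le g\<phi>)
  ultimately have "\<epsilon> \<le> 0"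
    by (rule LIMSEQ_le_const)
  then show False
    using \<epsilon> by simp
qed

text \<open>
  The finite Hahn-Banach argument is applied with the seminorm \<open>\<epsilon>\<close> times the supremum norm over
  \<open>U\<close>.
\<close>

lemma bp_continuous_near_evaluations:
  assumes U: "open U" "U \<noteq> {}" and \<phi>: "linear_functional_Hinf U \<phi>" "bp_continuous U \<phi>"
    and \<epsilon>: "0 < \<epsilon>"
  shows "\<exists>Z c. finite Z \<and> Z \<subseteq> U \<and> (\<forall>g\<in>Hinf_scalar U. \<forall>M.
    (\<forall>z\<in>U. norm (g z) \<le> M) \<longrightarrow> norm (\<phi> g - (\<Sum>z\<in>Z. c z * g z)) \<le> \<epsilon> * M)"
proof -
  obtain Z where Z: "finite Z" "Z \<subseteq> U" and small: "\<And>g. g \<in> Hinf_scalar U \<Longrightarrow>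
      (\<And>z. z \<in> U \<Longrightarrow> norm (g z) \<le> 1) \<Longrightarrow> (\<And>z. z \<in> Z \<Longrightarrow> g z = 0) \<Longrightarrow> norm (\<phi> g) \<le> \<epsilon>"
    using bp_continuous_small_if_vanishing[OF U \<phi> \<epsilon>] by metis
  define s where "s g = (SUP z\<in>U. norm (g z))" for g :: "complex ^ 'a \<Rightarrow> complex"
  have le_s: "norm (g z) \<le> s g" if "g \<in> Hinf_scalar U" "z \<in> U" for g z
  proof -
    have "bdd_above ((\<lambda>z. norm (g z)) ` U)"
      using that(1) unfolding Hinf_UNIV bounded_iff by (auto intro: bdd_aboveI)
    then show ?thesis
      unfolding s_def using that(2) by (rule cSUP_upper[rotated])
  qed
  have s_le: "s g \<le> M" if "\<And>z. z \<in> U \<Longrightarrow> norm (g z) \<le> M" for g M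
    unfolding s_def using U(2) that by (rule cSUP_least)
  have s_nonneg: "0 \<le> s g" if "g \<in> Hinf_scalar U" for g
    using U(2) le_s[OF that] norm_ge_zero order_trans by blast
  have space: "function_space (Hinf_scalar U)"
    by (rule function_space_Hinf)
  have mult_in: "(\<lambda>x. c * g x) \<in> Hinf_scalar U" if "g \<in> Hinf_scalar U" for c g
    using space that by (simp add: function_space_def)
  have mult_le: "s (\<lambda>x. c * g x) \<le> norm c * s g" if "g \<in> Hinf_scalar U" for c g
    using le_s[OF that] by (intro s_le) (simp add: norm_mult mult_left_mono)
  have mult_eq: "s (\<lambda>x. c * g x) = norm c * s g" if g: "g \<in> Hinf_scalar U" for c g
  proof (cases "c = 0")
    case True
    then show ?thesis
      using mult_le[OF g, of 0] s_nonneg[OF mult_in[OF g, of 0]] by simp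
  next
    case False
    then have "s g \<le> norm (inverse c) * s (\<lambda>x. c * g x)"
      using mult_le[OF mult_in[OF g, of c], of "inverse c"] by (simp add: mult.assoc[symmetric])
    then show ?thesis
      using False mult_le[OF g, of c] by (simp add: norm_inverse norm_divide field_simps)
  qed
  have "seminorm_on (Hinf_scalar U) (\<lambda>g. \<epsilon> * s g)"
    unfolding seminorm_on_def
  proof (intro conjI ballI allI)
    fix g h assume gh: "g \<in> Hinf_scalar U" "h \<in> Hinf_scalar U"
    have "norm (g z + h z) \<le> s g + s h" if "z \<in> U" for z
      using norm_triangle_mono[OF le_s[OF gh(1) that] le_s[OF gh(2) that]] .
    then have "s (\<lambda>x. g x + h x) \<le> s g + s h"
      by (rule s_le)
    then show "\<epsilon> * s (\<lambda>x. g x + h x) \<le> \<epsilon> * s g + \<epsilon> * s h"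
      using \<epsilon> by (simp flip: distrib_left)
  qed (simp add: mult_eq)
  moreover have functional: "functional_on (Hinf_scalar U) \<phi>"
    using \<phi>(1) unfolding functional_on_def linear_functional_Hinf_def by (elim conjE) (intro conjI)
  moreover have "norm (\<phi> g) \<le> \<epsilon> * s g" if g: "g \<in> Hinf_scalar U" and g0: "\<forall>z\<in>Z. g z = 0" for g
  proof (rule field_le_epsilon)
    fix e :: real assume e: "0 < e"
    \<comment> \<open>The summand \<open>e / \<epsilon>\<close> avoids a division by zero when \<open>g\<close> vanishes on \<open>U\<close>.\<close>
    define m where "m = s g + e / \<epsilon>"
    have m: "0 < m" "s g \<le> m"
      using e \<epsilon> s_nonneg[OF g] by (auto simp: m_def add_nonneg_pos)
    define b where "b = complex_of_real (inverse m)"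
    have b: "norm b = inverse m"
      using m by (simp add: b_def norm_inverse)
    have "norm (\<phi> (\<lambda>x. b * g x)) \<le> \<epsilon>"
    proof (rule small[OF mult_in[OF g]])
      show "norm (b * g z) \<le> 1" if "z \<in> U" for z
        using order_trans[OF le_s[OF g that] m(2)] m(1) by (simp add: norm_mult b field_simps)
    qed (use g0 in simp)
    moreover have "\<phi> (\<lambda>x. b * g x) = b * \<phi> g"
      using functional g by (simp add: functional_on_def)
    ultimately have "norm (\<phi> g) \<le> \<epsilon> * m"
      using m by (simp add: norm_mult b field_simps)
    also have "\<dots> = \<epsilon> * s g + e"
      using \<epsilon> by (simp add: m_def field_simps)
    finally show "norm (\<phi> g) \<le> \<epsilon> * s g + e" .
  qed
  ultimately obtain c where c: "\<And>g. g \<in> Hinf_scalar U \<Longrightarrow> norm (\<phi> g - (\<Sum>z\<in>Z. c z * g z)) \<le> \<epsilon> * s g"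
    using functional_on_near_evaluations[OF Z(1) space] by blast
  have "norm (\<phi> g - (\<Sum>z\<in>Z. c z * g z)) \<le> \<epsilon> * M"
    if g: "g \<in> Hinf_scalar U" and M: "\<And>z. z \<in> U \<Longrightarrow> norm (g z) \<le> M" for g M
  proof -
    have "\<epsilon> * s g \<le> \<epsilon> * M"
      using s_le[OF M] \<epsilon> by simp
    then show ?thesis
      using c[OF g] by linarith
  qed
  then show ?thesis
    using Z by (intro exI[of _ Z] exI[of _ c] conjI ballI allI impI) blast+
qed

section \<open>Vector-valued holomorphy and interchange with functionals\<close>

theorem theorem4p1:
  fixes \<Omega> :: "'w set"
    and E :: "('w discrete \<Rightarrow>\<^sub>C complex) set"
    and U :: "(complex ^ ('d :: {finite, linorder})) set"
    and f :: "(complex ^ ('d :: {finite, linorder})) \<times> 'w \<Rightarrow> complex"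
    and F :: "complex ^ ('d :: {finite, linorder}) \<Rightarrow> 'w discrete \<Rightarrow>\<^sub>C complex"
    and \<phi> :: "(complex ^ ('d :: {finite, linorder}) \<Rightarrow> complex) \<Rightarrow> complex"
  defines "F \<equiv> \<lambda>z. linfty_of \<Omega> (\<lambda>t. f (z, t))"
  assumes "E \<subseteq> linfty \<Omega>" and "complex_vector.subspace E" and "closed E"
    and "open U" and "U \<noteq> {}"
    and "bounded (f ` (U \<times> \<Omega>))"
    and "\<And>z. z \<in> U \<Longrightarrow> F z \<in> E"
    and "\<And>t. t \<in> \<Omega> \<Longrightarrow> holomorphic_into U UNIV (\<lambda>z. f (z, t))"
    and "linear_functional_Hinf U \<phi>" and "bp_continuous U \<phi>"
  shows "F \<in> Hinf U E \<and>
    (\<forall>\<alpha>. \<forall>a\<in>U.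
           fun_in \<Omega> (\<lambda>t. cD \<alpha> (\<lambda>z. f (z, t)) a) E \<and>
           cD \<alpha> F a = linfty_of \<Omega> (\<lambda>t. cD \<alpha> (\<lambda>z. f (z, t)) a) \<and>
           (\<forall>\<mu>\<in>dual_space E.
             cD \<alpha> (\<lambda>z. \<mu> (linfty_of \<Omega> (\<lambda>t. f (z, t)))) a =
             \<mu> (linfty_of \<Omega> (\<lambda>t. cD \<alpha> (\<lambda>z. f (z, t)) a)))) \<and>
    (fun_in \<Omega> (\<lambda>t. \<phi> (\<lambda>z. f (z, t))) (closure (complex_vector.span (F ` U))) \<and>
         closure (complex_vector.span (F ` U)) \<subseteq> E) \<and>
    (\<forall>\<mu>\<in>dual_space E.
           \<mu> (linfty_of \<Omega> (\<lambda>t. \<phi> (\<lambda>z. f (z, t)))) = \<phi> (\<lambda>z. \<mu> (F z)))"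
proof -
  note E = assms(3,4) and U = assms(5,6) and f_hol = assms(9) and \<phi> = assms(10,11)
  have FE: "F z \<in> E" if "z \<in> U" for z
    using assms(8) that .
  obtain C where C: "0 \<le> C" and f_le: "\<And>z t. z \<in> U \<Longrightarrow> t \<in> \<Omega> \<Longrightarrow> norm (f (z, t)) \<le> C"
  proof -
    obtain B where "\<And>y. y \<in> f ` (U \<times> \<Omega>) \<Longrightarrow> norm y \<le> B"
      using assms(7) bounded_iff by metis
    then show ?thesis
      by (intro that[of "max B 0"]) (auto intro: max.coboundedI1)
  qed
  have family: "hol_family U \<Omega> (\<lambda>t z. f (z, t))"
    unfolding hol_family_def
  proof (intro conjI ballI)
    show "hol U (\<lambda>z. f (z, t))" if "t \<in> \<Omega>" for t
      using f_hol[OF that] .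
    fix z assume "z \<in> U"
    then obtain r where "0 < r" "ball z r \<subseteq> U"
      using U(1) open_contains_ball by blast
    then show "\<exists>r>0. \<exists>C\<ge>0. ball z r \<subseteq> U \<and> (\<forall>w\<in>ball z r. \<forall>t\<in>\<Omega>. norm (f (w, t)) \<le> C)"
      using C f_le by blast
  qed
  have norm_F: "norm (F z) \<le> C" if "z \<in> U" for z
    unfolding F_def using f_le[OF that] C by (rule norm_linfty_of_le)
  have F_image: "F ` U \<subseteq> E"
    using FE by blast
  have F_Hinf: "F \<in> Hinf U E"
    unfolding Hinf_def holomorphic_into_def
  proof (intro CollectI conjI ballI)
    show "bounded (F ` U)"
      using norm_F by (auto simp: bounded_iff)
    fix z assume z: "z \<in> U"
    note d = hol_family_has_derivative[OF U(1) family z, folded F_def]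
    show "\<exists>L. (F has_derivative L) (at z) \<and> range L \<subseteq> E \<and> Vector_Spaces.linear (*s) (*\<^sub>C) L"
      using d derivative_in_closed_subspace[OF d U(1) z E F_image] by blast
  qed (rule F_image)
  have "represents U \<Omega> E F (\<lambda>t z. f (z, t)) (\<lambda>\<mu> z. \<mu> (F z))"
    unfolding represents_def using family FE by (simp add: F_def)
  then have rep: "represents U \<Omega> E (cD \<alpha> F) (\<lambda>t. cD \<alpha> (\<lambda>z. f (z, t))) (\<lambda>\<mu>. cD \<alpha> (\<lambda>z. \<mu> (F z)))" for \<alpha>
    by (rule represents_cD[OF U(1) E])
  have b: "fun_in \<Omega> (\<lambda>t. cD \<alpha> (\<lambda>z. f (z, t)) a) E \<and>
      cD \<alpha> F a = linfty_of \<Omega> (\<lambda>t. cD \<alpha> (\<lambda>z. f (z, t)) a) \<and>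
      (\<forall>\<mu>\<in>dual_space E. cD \<alpha> (\<lambda>z. \<mu> (linfty_of \<Omega> (\<lambda>t. f (z, t)))) a =
         \<mu> (linfty_of \<Omega> (\<lambda>t. cD \<alpha> (\<lambda>z. f (z, t)) a)))" if a: "a \<in> U" for \<alpha> a
  proof -
    have "hol_family U \<Omega> (\<lambda>t. cD \<alpha> (\<lambda>z. f (z, t)))"
      and *: "cD \<alpha> F a = linfty_of \<Omega> (\<lambda>t. cD \<alpha> (\<lambda>z. f (z, t)) a)" "cD \<alpha> F a \<in> E"
      "\<forall>\<mu>\<in>dual_space E. cD \<alpha> (\<lambda>z. \<mu> (F z)) a = \<mu> (cD \<alpha> F a)"
      using rep[of \<alpha>] a unfolding represents_def by blast+
    then have "bounded ((\<lambda>t. cD \<alpha> (\<lambda>z. f (z, t)) a) ` \<Omega>)"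
      using hol_family_bounded a by blast
    with * show ?thesis
      unfolding fun_in_def F_def by simp
  qed
  define \<psi> where "\<psi> t = \<phi> (\<lambda>z. f (z, t))" for t
  define comb where "comb Z c = (\<Sum>z\<in>Z. c z *\<^sub>C F z)" for Z c
  have f_Hinf: "(\<lambda>z. f (z, t)) \<in> Hinf_scalar U" if "t \<in> \<Omega>" for t
    using f_hol[OF that] f_le[OF _ that] by (auto simp: Hinf_UNIV bounded_iff)
  have F_bounded: "bounded ((\<lambda>t. f (z, t)) ` \<Omega>)" if "z \<in> U" for z
    using hol_family_bounded[OF family that] .
  \<comment> \<open>The coefficients do not depend on the function to which \<open>\<phi>\<close> is applied, so the error is uniform
    in \<open>t\<close>.\<close>
  have near: "bounded (\<psi> ` \<Omega>) \<and> norm (linfty_of \<Omega> \<psi> - comb Z c) \<le> \<epsilon> * C"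
    if \<epsilon>: "0 < \<epsilon>" and Z: "finite Z" "Z \<subseteq> U"
      and c: "\<forall>g\<in>Hinf_scalar U. \<forall>M. (\<forall>z\<in>U. norm (g z) \<le> M) \<longrightarrow>
        norm (\<phi> g - (\<Sum>z\<in>Z. c z * g z)) \<le> \<epsilon> * M" for \<epsilon> Z c
  proof -
    let ?s = "\<lambda>t. \<Sum>z\<in>Z. c z * f (z, t)"
    have s: "bounded (?s ` \<Omega>)" "linfty_of \<Omega> ?s = comb Z c"
      using linfty_of_sum[OF Z(1), of "\<lambda>z t. f (z, t)" \<Omega> c] F_bounded Z(2)
      by (auto simp: comb_def F_def)
    have err: "norm (\<psi> t - ?s t) \<le> \<epsilon> * C" if "t \<in> \<Omega>" for t
      unfolding \<psi>_def using c[rule_format, OF f_Hinf[OF that] f_le[OF _ that]] .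
    then have "bounded ((\<lambda>t. \<psi> t - ?s t) ` \<Omega>)"
      unfolding bounded_iff by blast
    from bounded_plus_comp[OF this s(1)] have \<psi>: "bounded (\<psi> ` \<Omega>)"
      by simp
    have "linfty_of \<Omega> \<psi> - comb Z c = linfty_of \<Omega> (\<lambda>t. \<psi> t - ?s t)"
      using linfty_of_diff[OF \<psi> s(1)] s(2) by simp
    also have "norm \<dots> \<le> \<epsilon> * C"
      using err \<epsilon> C by (intro norm_linfty_of_le) auto
    finally show ?thesis
      using \<psi> by blast
  qed
  have span_E: "closure (complex_vector.span (F ` U)) \<subseteq> E"
    using complex_vector.span_minimal[OF F_image E(1)] E(2) by (rule closure_minimal)
  have \<psi>_near: "bounded (\<psi> ` \<Omega>) \<and>
      (\<exists>y\<in>complex_vector.span (F ` U). dist y (linfty_of \<Omega> \<psi>) < e)" if e: "0 < e" for e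
  proof -
    define \<epsilon> where "\<epsilon> = e / (C + 1)"
    have \<epsilon>: "0 < \<epsilon>" "\<epsilon> * C < e"
      using e C by (auto simp: \<epsilon>_def field_simps)
    obtain Z c where Z: "finite Z" "Z \<subseteq> U" and c: "\<forall>g\<in>Hinf_scalar U. \<forall>M. (\<forall>z\<in>U. norm (g z) \<le> M) \<longrightarrow>
        norm (\<phi> g - (\<Sum>z\<in>Z. c z * g z)) \<le> \<epsilon> * M"
      using bp_continuous_near_evaluations[OF U \<phi> \<epsilon>(1)] by blast
    have "comb Z c \<in> complex_vector.span (F ` U)"
      unfolding comb_def using Z
      by (intro complex_vector.span_sum complex_vector.span_scale complex_vector.span_base) auto
    moreover have "dist (comb Z c) (linfty_of \<Omega> \<psi>) < e"
      using near[OF \<epsilon>(1) Z c] \<epsilon>(2) by (simp add: dist_norm norm_minus_commute)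
    ultimately show ?thesis
      using near[OF \<epsilon>(1) Z c] by blast
  qed
  have \<psi>_bounded: "bounded (\<psi> ` \<Omega>)"
    using \<psi>_near[of 1] by simp
  have \<psi>_span: "linfty_of \<Omega> \<psi> \<in> closure (complex_vector.span (F ` U))"
    unfolding closure_approachable using \<psi>_near by blast
  have d: "\<mu> (linfty_of \<Omega> \<psi>) = \<phi> (\<lambda>z. \<mu> (F z))" if \<mu>: "\<mu> \<in> dual_space E" for \<mu>
  proof -
    obtain K where K: "0 \<le> K" "\<And>x. x \<in> E \<Longrightarrow> norm (\<mu> x) \<le> K * norm x"
      using dual_space_bounded[OF \<mu> E(1)] by metis
    have \<mu>F: "(\<lambda>z. \<mu> (F z)) \<in> Hinf_scalar U"
      using Hinf_dual[OF F_Hinf U(1) E(1) \<mu>] .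
    have \<mu>F_le: "norm (\<mu> (F z)) \<le> K * C" if "z \<in> U" for z
      using K(2)[OF FE[OF that]] mult_left_mono[OF norm_F[OF that] K(1)] by linarith
    have "norm (\<mu> (linfty_of \<Omega> \<psi>) - \<phi> (\<lambda>z. \<mu> (F z))) \<le> 0 + e" if e: "0 < e" for e
    proof -
      define \<epsilon> where "\<epsilon> = e / (2 * (K * C) + 1)"
      have KC: "0 \<le> K * C"
        using K(1) C by simp
      have \<epsilon>: "0 < \<epsilon>" "2 * (\<epsilon> * (K * C)) \<le> e"
        using e KC by (auto simp: \<epsilon>_def field_simps)
      obtain Z c where Z: "finite Z" "Z \<subseteq> U" and c: "\<forall>g\<in>Hinf_scalar U. \<forall>M. (\<forall>z\<in>U. norm (g z) \<le> M) \<longrightarrow>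
        norm (\<phi> g - (\<Sum>z\<in>Z. c z * g z)) \<le> \<epsilon> * M"
        using bp_continuous_near_evaluations[OF U \<phi> \<epsilon>(1)] by blast
      have comb: "comb Z c \<in> E" "\<mu> (comb Z c) = (\<Sum>z\<in>Z. c z * \<mu> (F z))"
        using dual_space_sum[OF \<mu> E(1) Z(1), of F c] FE Z(2) by (auto simp: comb_def)
      have \<psi>E: "linfty_of \<Omega> \<psi> \<in> E"
        using \<psi>_span span_E by blast
      have "norm (\<mu> (linfty_of \<Omega> \<psi>) - \<mu> (comb Z c)) \<le> K * norm (linfty_of \<Omega> \<psi> - comb Z c)"
        using K(2)[OF complex_vector.subspace_diff[OF E(1) \<psi>E comb(1)]]
          dual_space_linear(3)[OF \<mu> E(1) \<psi>E comb(1)] by simp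
      also have "\<dots> \<le> K * (\<epsilon> * C)"
        using near[OF \<epsilon>(1) Z c] K(1) by (intro mult_left_mono) auto
      finally have 1: "norm (\<mu> (linfty_of \<Omega> \<psi>) - \<mu> (comb Z c)) \<le> \<epsilon> * (K * C)"
        by (simp add: mult_ac)
      have 2: "norm (\<phi> (\<lambda>z. \<mu> (F z)) - \<mu> (comb Z c)) \<le> \<epsilon> * (K * C)"
        using c[rule_format, OF \<mu>F \<mu>F_le] comb(2) by simp
      show ?thesis
        using norm_triangle_ineq4[of "\<mu> (linfty_of \<Omega> \<psi>) - \<mu> (comb Z c)"
            "\<phi> (\<lambda>z. \<mu> (F z)) - \<mu> (comb Z c)"] 1 2 \<epsilon>(2) by simp
    qed
    then have "norm (\<mu> (linfty_of \<Omega> \<psi>) - \<phi> (\<lambda>z. \<mu> (F z))) \<le> 0"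
      by (rule field_le_epsilon)
    then show ?thesis by simp
  qed
  show ?thesis
    using F_Hinf b \<psi>_bounded \<psi>_span span_E d unfolding fun_in_def \<psi>_def by blast
qed

end
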